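(* Every left-linear generalized semi-monadic TRS (GSM-TRS) $R$ is an EPRF-TRS.
   Context: A ranked alphabet $\Sigma$ is a finite set of symbols each with a rank in $\mathbb{N}$; $\Sigma_m$ is the set of symbols of rank $m$. $X=\{x_1,x_2,\dots\}$ is a countable set of variables, $T_\Sigma(X)$ the set of terms over $\Sigma$ and $X$, $T_\Sigma$ the ground terms. For a term $t$, $POS(t)$ is its set of positions (words over $\mathbb{N}$, $\lambda$ the root), $t/\alpha$ the subterm at $\alpha$, $var(t)$ its variables. A term is linear if no variable occurs twice in it. A term $u$ is a supertree of $v$ if $u$ is linear and $v=\sigma(u)$ for some substitution $\sigma$. A TRS $R$ over $\Sigma$ is a finite set of rules $l\to r$ with $l,r\in T_\Sigma(X)$ and $var(r)\subseteq var(l)$; $\Rightarrow_R$ is the one-step rewrite relation and $\Rightarrow_R^*$ its reflexive transitive closure. $R$ is left-linear if every left-hand side is linear. $sign(R)$ is the set of symbols occurring in rules of $R$. For a tree language $L\subseteq T_\Sigma$, $R^*_\Sigma(L)=\{p\mid q\Rightarrow^*_R p \text{ for some } q\in L\}$. A bottom-up tree automaton (bta) over $\Sigma$ is $(\Sigma,A,\Delta,A_f)$ with finite state set $A$ (states as constants), final states $A_f$, and rules $\delta(a_1,\dots,a_n)\to a$ ($\delta\in\Sigma_n$, $a_i,a\in A$) and $a\to a'$; it recognizes $\{t\in T_\Sigma\mid t\Rightarrow^* a \text{ for some } a\in A_f\}$. A TRS $R$ over $sign(R)$ is an EPRF-TRS if, given any ranked alphabet $\Sigma\supseteq sign(R)$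 and any finite tree language $L\subseteq T_\Sigma$, one can effectively construct a bta $\mathcal{C}$ over $\Sigma$ with $L(\mathcal{C})=R^*_\Sigma(L)$ (where $R$ is regarded as a TRS over $\Sigma$). A TRS $R$ over $\Sigma$ is a GSM-TRS if it has no rule $l\to r$ with $l\in X$, and the following holds: for any rules $l_1\to r_1$ and $l_2\to r_2$ in $R$, any positions $\alpha\in POS(r_1)$, $\beta\in POS(l_2)$, and any supertree $l_3\in T_\Sigma(X)$ of $l_2/\beta$ with $var(l_3)\cap var(l_1)=\emptyset$, if (i) $\alpha=\lambda$ or $\beta=\lambda$, (ii) $r_1/\alpha$ and $l_3$ are unifiable, and (iii) $\sigma$ is a most general unifier of $r_1/\alpha$ and $l_3$, then (a) $l_2/\beta\in X$, or (b) for each $\gamma\in POS(l_3)$, if $l_2/\beta\gamma\in X$ then $\sigma(l_3/\gamma)\in X\cup T_\Sigma$. *)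

theory Defs
  imports Main "HOL-Library.Nat_Bijection"
begin

section \<open>Terms\<close>

datatype (funs: 'f, vars: 'v) trm =
    is_Var: Var 'v
  | Fun 'f "('f, 'v) trm list"
  for map: map_trm

text \<open>A symbol is a name together with its rank, so every symbol has exactly one rank. A
  ranked alphabet is a finite set of symbols. Names are natural numbers, because alphabets occur as
  inputs of algorithms in the definition of an EPRF-TRS. The variables are \<open>Var 0, Var 1, \<dots>\<close>.\<close>

type_synonym symb = "nat \<times> nat"

abbreviation rank :: "symb \<Rightarrow> nat" where
  "rank \<equiv> snd"

definition ranked_alphabet :: "symb set \<Rightarrow> bool" where
  "ranked_alphabet \<Sigma> \<longleftrightarrow> finite \<Sigma>"

inductive_set terms :: "symb set \<Rightarrow> (symb, nat) trm set" for \<Sigma> where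
  Var: "Var x \<in> terms \<Sigma>"
| Fun: "f \<in> \<Sigma> \<Longrightarrow> length ts = rank f \<Longrightarrow> (\<And>t. t \<in> set ts \<Longrightarrow> t \<in> terms \<Sigma>) \<Longrightarrow> Fun f ts \<in> terms \<Sigma>"

definition ground_terms :: "symb set \<Rightarrow> (symb, nat) trm set" where
  "ground_terms \<Sigma> = {t \<in> terms \<Sigma>. vars t = {}}"

text \<open>Positions are words over the natural numbers; the arguments of a symbol are numbered from 0.
  \<open>subt t p\<close> is only meaningful for \<open>p \<in> POS t\<close>.\<close>

fun is_pos :: "('f, 'v) trm \<Rightarrow> nat list \<Rightarrow> bool" where
  "is_pos t [] \<longleftrightarrow> True"
| "is_pos (Var x) (i # p) \<longleftrightarrow> False"
| "is_pos (Fun f ts) (i # p) \<longleftrightarrow> i < length ts \<and> is_pos (ts ! i) p"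

definition POS :: "('f, 'v) trm \<Rightarrow> nat list set" where
  "POS t = {p. is_pos t p}"

fun subt :: "('f, 'v) trm \<Rightarrow> nat list \<Rightarrow> ('f, 'v) trm" where
  "subt t [] = t"
| "subt (Fun f ts) (i # p) = subt (ts ! i) p"
| "subt (Var x) (i # p) = undefined"

definition linear :: "('f, 'v) trm \<Rightarrow> bool" where
  "linear t \<longleftrightarrow> (\<forall>p \<in> POS t. \<forall>q \<in> POS t. \<forall>x. subt t p = Var x \<and> subt t q = Var x \<longrightarrow> p = q)"


section \<open>Substitutions and unification\<close>

primrec subst :: "('v \<Rightarrow> ('f, 'w) trm) \<Rightarrow> ('f, 'v) trm \<Rightarrow> ('f, 'w) trm" where
  "subst \<sigma> (Var x) = \<sigma> x"
| "subst \<sigma> (Fun f ts) = Fun f (map (subst \<sigma>) ts)"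

definition substitutions :: "symb set \<Rightarrow> (nat \<Rightarrow> (symb, nat) trm) set" where
  "substitutions \<Sigma> = {\<sigma>. \<forall>x. \<sigma> x \<in> terms \<Sigma>}"

definition supertree :: "symb set \<Rightarrow> (symb, nat) trm \<Rightarrow> (symb, nat) trm \<Rightarrow> bool" where
  "supertree \<Sigma> u v \<longleftrightarrow> linear u \<and> (\<exists>\<sigma> \<in> substitutions \<Sigma>. v = subst \<sigma> u)"

definition unifiers :: "symb set \<Rightarrow> (symb, nat) trm \<Rightarrow> (symb, nat) trm \<Rightarrow> (nat \<Rightarrow> (symb, nat) trm) set"
  where
  "unifiers \<Sigma> s t = {\<sigma> \<in> substitutions \<Sigma>. subst \<sigma> s = subst \<sigma> t}"

definition unifiable :: "symb set \<Rightarrow> (symb, nat) trm \<Rightarrow> (symb, nat) trm \<Rightarrow> bool" where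
  "unifiable \<Sigma> s t \<longleftrightarrow> unifiers \<Sigma> s t \<noteq> {}"

definition is_mgu ::
  "symb set \<Rightarrow> (nat \<Rightarrow> (symb, nat) trm) \<Rightarrow> (symb, nat) trm \<Rightarrow> (symb, nat) trm \<Rightarrow> bool" where
  "is_mgu \<Sigma> \<sigma> s t \<longleftrightarrow> \<sigma> \<in> unifiers \<Sigma> s t \<and>
     (\<forall>\<tau> \<in> unifiers \<Sigma> s t. \<exists>\<rho> \<in> substitutions \<Sigma>. \<forall>x. \<tau> x = subst \<rho> (\<sigma> x))"


section \<open>Term rewrite systems\<close>

type_synonym ('f, 'v) rule = "('f, 'v) trm \<times> ('f, 'v) trm"

inductive rstep :: "('f, 'v) rule set \<Rightarrow> ('f, 'v) trm \<Rightarrow> ('f, 'v) trm \<Rightarrow> bool" for R where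
  root: "(l, r) \<in> R \<Longrightarrow> rstep R (subst \<sigma> l) (subst \<sigma> r)"
| arg: "rstep R s t \<Longrightarrow> rstep R (Fun f (us @ s # vs)) (Fun f (us @ t # vs))"

definition trs :: "symb set \<Rightarrow> (symb, nat) rule set \<Rightarrow> bool" where
  "trs \<Sigma> R \<longleftrightarrow> finite R \<and> (\<forall>(l, r) \<in> R. l \<in> terms \<Sigma> \<and> r \<in> terms \<Sigma> \<and> vars r \<subseteq> vars l)"

definition left_linear :: "(symb, nat) rule set \<Rightarrow> bool" where
  "left_linear R \<longleftrightarrow> (\<forall>(l, r) \<in> R. linear l)"

definition sign :: "(symb, nat) rule set \<Rightarrow> symb set" where
  "sign R = (\<Union>(l, r) \<in> R. funs l \<union> funs r)"

text \<open>No alphabet occurs here: if \<open>R\<close> is a TRS over \<open>\<Sigma>\<close>, then rewriting starting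
  from a term over \<open>\<Sigma>\<close> stays within the terms over \<open>\<Sigma>\<close>.\<close>

definition descendants :: "(symb, nat) rule set \<Rightarrow> (symb, nat) trm set \<Rightarrow> (symb, nat) trm set" where
  "descendants R L = {p. \<exists>q \<in> L. (rstep R)\<^sup>*\<^sup>* q p}"

definition gsm_trs :: "symb set \<Rightarrow> (symb, nat) rule set \<Rightarrow> bool" where
  "gsm_trs \<Sigma> R \<longleftrightarrow> trs \<Sigma> R \<and> (\<forall>(l, r) \<in> R. \<not> is_Var l) \<and>
     (\<forall>(l1, r1) \<in> R. \<forall>(l2, r2) \<in> R. \<forall>\<alpha> \<in> POS r1. \<forall>\<beta> \<in> POS l2. \<forall>l3 \<in> terms \<Sigma>. \<forall>\<sigma>.
        supertree \<Sigma> l3 (subt l2 \<beta>) \<and> vars l3 \<inter> vars l1 = {} \<and>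
        (\<alpha> = [] \<or> \<beta> = []) \<and>
        unifiable \<Sigma> (subt r1 \<alpha>) l3 \<and>
        is_mgu \<Sigma> \<sigma> (subt r1 \<alpha>) l3
        \<longrightarrow> is_Var (subt l2 \<beta>) \<or>
            (\<forall>\<gamma> \<in> POS l3. is_Var (subt l2 (\<beta> @ \<gamma>)) \<longrightarrow>
               is_Var (subst \<sigma> (subt l3 \<gamma>)) \<or> subst \<sigma> (subt l3 \<gamma>) \<in> ground_terms \<Sigma>))"


section \<open>Bottom-up tree automata\<close>

text \<open>The rules of an automaton are rewrite rules over the disjoint union of the alphabet and the
  states, the latter being constants; \<open>rewrite_rule\<close> makes this explicit.\<close>

datatype bta_rule = Trans symb "nat list" nat | Eps nat nat

record bta =
  alphabet :: "symb set"
  states :: "nat set"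
  rules :: "bta_rule set"
  finals :: "nat set"

fun wf_rule :: "symb set \<Rightarrow> nat set \<Rightarrow> bta_rule \<Rightarrow> bool" where
  "wf_rule \<Sigma> A (Trans f as a) \<longleftrightarrow> f \<in> \<Sigma> \<and> length as = rank f \<and> set as \<subseteq> A \<and> a \<in> A"
| "wf_rule \<Sigma> A (Eps a a') \<longleftrightarrow> a \<in> A \<and> a' \<in> A"

definition bta_over :: "symb set \<Rightarrow> bta \<Rightarrow> bool" where
  "bta_over \<Sigma> C \<longleftrightarrow> alphabet C = \<Sigma> \<and> finite (states C) \<and> finals C \<subseteq> states C \<and>
     finite (rules C) \<and> (\<forall>\<rho> \<in> rules C. wf_rule \<Sigma> (states C) \<rho>)"

definition state :: "nat \<Rightarrow> (symb + nat, nat) trm" where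
  "state a = Fun (Inr a) []"

fun rewrite_rule :: "bta_rule \<Rightarrow> (symb + nat, nat) rule" where
  "rewrite_rule (Trans f as a) = (Fun (Inl f) (map state as), state a)"
| "rewrite_rule (Eps a a') = (state a, state a')"

definition bta_lang :: "bta \<Rightarrow> (symb, nat) trm set" where
  "bta_lang C = {t \<in> ground_terms (alphabet C).
     \<exists>a \<in> finals C. (rstep (rewrite_rule ` rules C))\<^sup>*\<^sup>* (map_trm Inl id t) (state a)}"


section \<open>Effectivity\<close>

text \<open>Algorithms are partial recursive functions, given by their defining expressions.
  \<open>computes e xs y\<close> says that \<open>e\<close> is defined on the arguments \<open>xs\<close> with value \<open>y\<close>.\<close>

datatype recf = Zero | Succ | Proj nat | Comp recf "recf list" | PrimRec recf recf | Mu recf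

inductive computes :: "recf \<Rightarrow> nat list \<Rightarrow> nat \<Rightarrow> bool" where
  Zero: "computes Zero xs 0"
| Succ: "computes Succ [x] (Suc x)"
| Proj: "i < length xs \<Longrightarrow> computes (Proj i) xs (xs ! i)"
| Comp: "list_all2 (\<lambda>g y. computes g xs y) gs ys \<Longrightarrow> computes f ys z \<Longrightarrow> computes (Comp f gs) xs z"
| PrimRec_0: "computes g xs y \<Longrightarrow> computes (PrimRec g h) (0 # xs) y"
| PrimRec_Suc: "computes (PrimRec g h) (n # xs) y \<Longrightarrow> computes h (n # y # xs) z
    \<Longrightarrow> computes (PrimRec g h) (Suc n # xs) z"
| Mu: "computes f (n # xs) 0 \<Longrightarrow> (\<And>m. m < n \<Longrightarrow> \<exists>y > 0. computes f (m # xs) y)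
    \<Longrightarrow> computes (Mu f) xs n"

text \<open>Inputs and outputs are finite objects, coded by the explicit (computable) bijections of
  \<^theory>\<open>HOL-Library.Nat_Bijection\<close>. In particular a finite set of numbers has a canonical code,
  so the result of an algorithm cannot depend on an enumeration of its input.\<close>

primrec term_code :: "(symb, nat) trm \<Rightarrow> nat" where
  "term_code (Var x) = sum_encode (Inl x)"
| "term_code (Fun f ts) = sum_encode (Inr (prod_encode (prod_encode f, list_encode (map term_code ts))))"

fun rule_code :: "bta_rule \<Rightarrow> nat" where
  "rule_code (Trans f as a) =
     sum_encode (Inl (prod_encode (prod_encode f, prod_encode (list_encode as, a))))"
| "rule_code (Eps a a') = sum_encode (Inr (prod_encode (a, a')))"

definition alphabet_code :: "symb set \<Rightarrow> nat" where
  "alphabet_code \<Sigma> = set_encode (prod_encode ` \<Sigma>)"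

definition lang_code :: "(symb, nat) trm set \<Rightarrow> nat" where
  "lang_code L = set_encode (term_code ` L)"

definition bta_code :: "bta \<Rightarrow> nat" where
  "bta_code C = prod_encode (alphabet_code (alphabet C), prod_encode (set_encode (states C),
     prod_encode (set_encode (rule_code ` rules C), set_encode (finals C))))"

text \<open>\<open>R\<close> is fixed; the algorithm \<open>e\<close> is uniform in \<open>\<Sigma>\<close> and \<open>L\<close>.\<close>

definition eprf_trs :: "(symb, nat) rule set \<Rightarrow> bool" where
  "eprf_trs R \<longleftrightarrow> trs (sign R) R \<and>
     (\<exists>e. \<forall>\<Sigma> L. ranked_alphabet \<Sigma> \<and> sign R \<subseteq> \<Sigma> \<and> finite L \<and> L \<subseteq> ground_terms \<Sigma> \<longrightarrow>
        (\<exists>C. computes e [alphabet_code \<Sigma>, lang_code L] (bta_code C) \<and>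
             bta_over \<Sigma> C \<and> bta_lang C = descendants R L))"

end

theory Submission
  imports Defs
begin

text \<open>The states of the automaton are ground terms, and the state \<open>s\<close> accepts the descendants of \<open>s\<close>:
  there are transitions \<open>f(s\<^sub>1, \<dots>, s\<^sub>n) \<rightarrow> s\<close> for \<open>s = f(s\<^sub>1, \<dots>, s\<^sub>n)\<close>, and whenever a left-hand side
  \<open>l\<close> instantiated by states \<open>\<sigma>\<close> runs to \<open>s\<close>, there is a rule from \<open>\<sigma>(r)\<close> to \<open>s\<close>. Since each state stands for
  the descendants of a single term, non-right-linear rules do no harm. Let \<open>B\<close> consist of the subterms
  of \<open>L\<close> and the ground subterms of right-hand sides. The GSM condition implies that, on states of the form
  \<open>\<sigma>(r/\<alpha>)\<close> with \<open>\<sigma>\<close> into \<open>B\<close>, every run of a left-hand side binds its variables in \<open>B\<close> again,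
  so finitely many states suffice.

  Being saturated in this sense is expressible by a formula with bounded quantifiers over the codes of the
  states and of the rules, hence decidable, and some saturated automaton exists; so one is found by
  unbounded search. Soundness need not be checked: the rules \<open>a \<rightarrow> b\<close> with \<open>b \<Rightarrow>\<^sup>* a\<close> are themselves
  saturated, so the search asks for a set of rules with least code, which must be sound.\<close>

section \<open>Terms and positions\<close>

text \<open>The output must come from a \<open>recf\<close>. Building the automaton by recursion on
  codes would be laborious, while a search needs only a decidable test. Soundness resists a bounded
  test, since \<open>b \<Rightarrow>\<^sup>* a\<close> involves derivations of unbounded length;
  this is what minimality is for. Because soundness comes for free, the relation that proves
  existence may be grossly unsound: it sends every instance of a right-hand side to all states, and
  only the finiteness of the state set is at stake. For that, the GSM condition is applied along
  single paths of \<open>l2\<close>, so supertrees that keep one path suffice. Left-linearity acts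
  in completeness, where a run on an instance of \<open>l\<close> has to determine one state for
  each variable.\<close>

lemma POS_Nil [simp]: "[] \<in> POS t"
  by (simp add: POS_def)

lemma POS_Var [simp]: "p \<in> POS (Var x) \<longleftrightarrow> p = []"
  by (cases p) (auto simp: POS_def)

lemma POS_Fun_Cons [simp]: "i # p \<in> POS (Fun f ts) \<longleftrightarrow> i < length ts \<and> p \<in> POS (ts ! i)"
  by (simp add: POS_def)

lemma POS_Fun: "POS (Fun f ts) = insert [] (\<Union>i<length ts. (#) i ` POS (ts ! i))"
proof -
  have "p \<in> POS (Fun f ts) \<longleftrightarrow> p \<in> insert [] (\<Union>i<length ts. (#) i ` POS (ts ! i))" for p
    by (cases p) auto
  then show ?thesis by blast
qed

lemma finite_POS: "finite (POS t)"
proof (induction t)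
  case (Var x)
  have "POS (Var x :: ('a, 'b) trm) = {[]}" by auto
  then show ?case by simp
next
  case (Fun f ts)
  then show ?case by (simp add: POS_Fun)
qed

lemma POS_append: "p @ q \<in> POS t \<longleftrightarrow> p \<in> POS t \<and> q \<in> POS (subt t p)"
proof (induction p arbitrary: t)
  case (Cons i p)
  then show ?case by (cases t) auto
qed simp

lemma subt_append: "p \<in> POS t \<Longrightarrow> subt t (p @ q) = subt (subt t p) q"
proof (induction p arbitrary: t)
  case (Cons i p)
  then show ?case by (cases t) auto
qed simp

lemma vars_subt: "p \<in> POS t \<Longrightarrow> vars (subt t p) \<subseteq> vars t"
proof (induction p arbitrary: t)
  case (Cons i p)
  show ?case
  proof (cases t)
    case (Fun f ts)
    with Cons.prems have "vars (subt (ts ! i) p) \<subseteq> vars (ts ! i)" "ts ! i \<in> set ts"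
      using Cons.IH by auto
    then show ?thesis using Fun by auto
  qed (use Cons.prems in simp)
qed simp

lemma vars_iff_POS: "x \<in> vars t \<longleftrightarrow> (\<exists>p \<in> POS t. subt t p = Var x)"
proof
  show "\<exists>p \<in> POS t. subt t p = Var x" if "x \<in> vars t"
    using that
  proof (induction t)
    case (Var y)
    then show ?case by simp
  next
    case (Fun f ts)
    then obtain i where i: "i < length ts" "x \<in> vars (ts ! i)"
      by (auto simp: in_set_conv_nth)
    with Fun.IH[of "ts ! i"] obtain p where "p \<in> POS (ts ! i)" "subt (ts ! i) p = Var x"
      by auto
    with i show ?case by (intro bexI[of _ "i # p"]) auto
  qed
next
  assume "\<exists>p \<in> POS t. subt t p = Var x"
  then show "x \<in> vars t" using vars_subt by fastforce
qed

section \<open>Terms over an alphabet, substitution and linearity\<close>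

lemma terms_Fun_iff:
  "Fun f ts \<in> terms \<Sigma> \<longleftrightarrow> f \<in> \<Sigma> \<and> length ts = rank f \<and> set ts \<subseteq> terms \<Sigma>"
  by (auto intro: terms.intros elim: terms.cases)

lemma terms_Var [simp]: "Var x \<in> terms \<Sigma>"
  by (rule terms.Var)

lemma subt_terms: "t \<in> terms \<Sigma> \<Longrightarrow> p \<in> POS t \<Longrightarrow> subt t p \<in> terms \<Sigma>"
proof (induction p arbitrary: t)
  case (Cons i p)
  then show ?case by (cases t) (auto simp: terms_Fun_iff subset_iff)
qed simp

lemma terms_funs: "t \<in> terms \<Sigma> \<Longrightarrow> funs t \<subseteq> \<Sigma>' \<Longrightarrow> t \<in> terms \<Sigma>'"
proof (induction t)
  case (Fun f ts)
  then show ?case by (fastforce simp: terms_Fun_iff)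
qed simp

lemma subst_terms:
  "t \<in> terms \<Sigma> \<Longrightarrow> (\<And>x. x \<in> vars t \<Longrightarrow> \<sigma> x \<in> terms \<Sigma>) \<Longrightarrow> subst \<sigma> t \<in> terms \<Sigma>"
proof (induction t)
  case (Fun f ts)
  then show ?case by (fastforce simp: terms_Fun_iff)
qed simp

lemma subst_cong: "(\<And>x. x \<in> vars t \<Longrightarrow> \<sigma> x = \<tau> x) \<Longrightarrow> subst \<sigma> t = subst \<tau> t"
  by (induction t) auto

lemma subst_Var: "subst Var t = t"
  by (induction t) (auto simp: map_idI)

lemma vars_subst: "vars (subst \<sigma> t) = (\<Union>x \<in> vars t. vars (\<sigma> x))"
  by (induction t) auto

lemma subt_subst: "p \<in> POS t \<Longrightarrow> subt (subst \<sigma> t) p = subst \<sigma> (subt t p)"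
proof (induction p arbitrary: t)
  case (Cons i p)
  then show ?case by (cases t) auto
qed simp

lemma finite_vars: "finite (vars t)"
  by (induction t) auto

lemma linear_arg:
  assumes "linear (Fun f ts)" "i < length ts"
  shows "linear (ts ! i)"
  unfolding linear_def
proof (intro ballI allI impI)
  fix p q x
  assume "p \<in> POS (ts ! i)" "q \<in> POS (ts ! i)" "subt (ts ! i) p = Var x \<and> subt (ts ! i) q = Var x"
  then have "i # p = i # q"
    using assms unfolding linear_def
    by (metis POS_Fun_Cons subt.simps(2))
  then show "p = q" by simp
qed

lemma linear_args_disjoint:
  assumes "linear (Fun f ts)" "i < length ts" "j < length ts"
    and "x \<in> vars (ts ! i)" "x \<in> vars (ts ! j)"
  shows "i = j"
proof -
  from assms(4,5) obtain p q where "p \<in> POS (ts ! i)" "subt (ts ! i) p = Var x"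
    "q \<in> POS (ts ! j)" "subt (ts ! j) q = Var x"
    by (auto simp: vars_iff_POS)
  then have "i # p = j # q"
    using assms(1-3) unfolding linear_def by (metis POS_Fun_Cons subt.simps(2))
  then show ?thesis by simp
qed

lemma rstep_args:
  assumes "list_all2 (rstep R)\<^sup>*\<^sup>* ss ts"
  shows "(rstep R)\<^sup>*\<^sup>* (Fun f (us @ ss)) (Fun f (us @ ts))"
  using assms
proof (induction arbitrary: us rule: list_all2_induct)
  case (Cons s ss t ts)
  have "(rstep R)\<^sup>*\<^sup>* (Fun f (us @ s # ss)) (Fun f (us @ t # ss))"
    using Cons.hyps(1) by (induction) (auto intro: rtranclp.rtrancl_into_rtrancl rstep.arg)
  with Cons.IH[of "us @ [t]"] show ?case by simp
qed simp

section \<open>The overlap condition\<close>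

text \<open>The agreement that matching along a single path needs. Nothing is required at the end of
  the path or beside it, where the supertree will carry variables.\<close>

fun spine :: "('f, 'v) trm \<Rightarrow> ('f, 'w) trm \<Rightarrow> nat list \<Rightarrow> bool" where
  "spine t u [] \<longleftrightarrow> True"
| "spine (Fun f ts) (Fun g us) (i # p) \<longleftrightarrow>
     f = g \<and> length ts = length us \<and> i < length ts \<and> spine (ts ! i) (us ! i) p"
| "spine _ _ _ \<longleftrightarrow> False"

text \<open>A supertree may be cut off at any set of positions. If everything off a single path is cut, then
  it unifies with \<open>r1/\<alpha>\<close> by mere matching, which instantiates no variable of \<open>r1\<close>; the condition on
  the most general unifier becomes a condition on a subterm of \<open>r1\<close>. The variable at the position
  \<open>p\<close> is \<open>\<nu> p\<close>.\<close>

fun spine_term :: "(nat list \<Rightarrow> 'v) \<Rightarrow> ('f, 'w) trm \<Rightarrow> nat list \<Rightarrow> ('f, 'v) trm" where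
  "spine_term \<nu> (Fun g us) (i # p) = Fun g (map (\<lambda>j. if j = i
     then spine_term (\<lambda>q. \<nu> (i # q)) (us ! i) p else Var (\<nu> [j])) [0..<length us])"
| "spine_term \<nu> u _ = Var (\<nu> [])"

lemma spine_refl: "p \<in> POS t \<Longrightarrow> spine t t p"
proof (induction p arbitrary: t)
  case (Cons i p)
  then show ?case by (cases t) auto
qed simp

lemma spine_POS: "spine t u p \<Longrightarrow> p \<in> POS t \<and> p \<in> POS u"
  by (induction t u p rule: spine.induct) auto

lemma spine_snoc:
  assumes "spine t u p" "subt t p = Fun f ts" "subt u p = Fun f us"
    and "length ts = length us" "i < length ts"
  shows "spine t u (p @ [i])"
  using assms by (induction t u p rule: spine.induct) auto

lemma spine_term_POS: "spine t u p \<Longrightarrow> p \<in> POS (spine_term \<nu> u p)"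
  by (induction t u p arbitrary: \<nu> rule: spine.induct) auto

lemma spine_term_subt: "spine t u p \<Longrightarrow> subt (spine_term \<nu> u p) p = Var (\<nu> p)"
  by (induction t u p arbitrary: \<nu> rule: spine.induct) auto

text \<open>Cutting leaves no position that \<open>t\<close> lacks, so every variable has a subterm
  of \<open>t\<close> to be matched with. As a variable is named after its position, an injective
  \<open>\<nu>\<close> makes the cut term linear.\<close>

lemma spine_term_var:
  assumes "spine t u p" "q \<in> POS (spine_term \<nu> u p)"
  shows "q \<in> POS t \<and> (\<forall>x. subt (spine_term \<nu> u p) q = Var x \<longrightarrow> x = \<nu> q)"
  using assms
proof (induction t u p arbitrary: \<nu> q rule: spine.induct)
  case (1 t u)
  then show ?case by auto
next
  case (2 f ts g us i p)
  show ?case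
  proof (cases q)
    case (Cons j q')
    show ?thesis
    proof (cases "j = i")
      case True
      then show ?thesis
        using 2(1)[of q' "\<lambda>q. \<nu> (i # q)"] 2(2,3) Cons by auto
    next
      case False
      then show ?thesis using 2(2,3) Cons by auto
    qed
  qed simp
qed auto

text \<open>Serves twice: for the given \<open>t\<close> it yields the match, and with
  \<open>u\<close> in the place of \<open>t\<close> it shows that the cut term is a supertree of
  \<open>u\<close>.\<close>

lemma spine_term_instance:
  assumes "spine t u p" "\<And>q. q \<in> POS t \<Longrightarrow> \<psi> (\<nu> q) = subt t q"
  shows "subst \<psi> (spine_term \<nu> u p) = t"
  using assms
proof (induction t u p arbitrary: \<nu> rule: spine.induct)
  case (1 t u)
  then show ?case by force
next
  case (2 f ts g us i p)
  have "subst \<psi> (spine_term (\<lambda>q. \<nu> (i # q)) (us ! i) p) = ts ! i"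
    using 2(1)[of "\<lambda>q. \<nu> (i # q)"] 2(2) 2(3)[of "i # _"] by auto
  moreover have "\<psi> (\<nu> [j]) = ts ! j" if "j < length ts" for j
    using that 2(3)[of "[j]"] by auto
  ultimately show ?case
    using 2(2) by (auto intro!: nth_equalityI)
qed auto

lemma spine_term_terms: "spine t u p \<Longrightarrow> u \<in> terms \<Sigma> \<Longrightarrow> spine_term \<nu> u p \<in> terms \<Sigma>"
  by (induction t u p arbitrary: \<nu> rule: spine.induct)
    (auto simp: terms_Fun_iff subset_iff)

lemma gsm_overlap:
  assumes gsm: "gsm_trs \<Sigma> R" and R1: "(l1, r1) \<in> R" and R2: "(l2, r2) \<in> R"
    and \<alpha>: "\<alpha> \<in> POS r1" and \<beta>: "\<beta> \<in> POS l2" and root: "\<alpha> = [] \<or> \<beta> = []"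
    and sp: "spine (subt r1 \<alpha>) (subt l2 \<beta>) \<gamma>"
    and nv: "\<not> is_Var (subt l2 \<beta>)" and v: "is_Var (subt l2 (\<beta> @ \<gamma>))"
  shows "is_Var (subt r1 (\<alpha> @ \<gamma>)) \<or> vars (subt r1 (\<alpha> @ \<gamma>)) = {}"
proof -
  define t where "t = subt r1 \<alpha>"
  define u where "u = subt l2 \<beta>"
  \<comment> \<open>The offset exceeds all variables of \<open>l1\<close>, from which
    \<open>l3\<close> has to be disjoint; \<open>list_encode\<close> keeps the names of different
    positions apart.\<close>
  define \<nu> where "\<nu> p = Suc (Max (insert 0 (vars l1))) + list_encode p" for p
  define l3 where "l3 = spine_term \<nu> u \<gamma>"
  have trs: "trs \<Sigma> R" using gsm by (simp add: gsm_trs_def)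
  have sp: "spine t u \<gamma>" using sp by (simp add: t_def u_def)
  have t: "t \<in> terms \<Sigma>" and u: "u \<in> terms \<Sigma>"
    using trs R1 R2 \<alpha> \<beta> by (auto simp: trs_def t_def u_def intro: subt_terms)
  have inj: "\<nu> p = \<nu> q \<longleftrightarrow> p = q" for p q
    by (simp add: \<nu>_def list_encode_eq)
  have fresh: "\<nu> p \<notin> vars l1" for p
  proof
    assume "\<nu> p \<in> vars l1"
    then have "\<nu> p \<le> Max (insert 0 (vars l1))" by (simp add: finite_vars)
    then show False by (simp add: \<nu>_def)
  qed
  have var_t: "vars t \<subseteq> vars l1"
    using trs R1 \<alpha> vars_subt[OF \<alpha>] by (fastforce simp: trs_def t_def)
  have var_l3: "x \<in> vars l3 \<Longrightarrow> \<exists>q. x = \<nu> q \<and> q \<in> POS l3 \<and> q \<in> POS t \<and> subt l3 q = Var x" for x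
  proof -
    assume "x \<in> vars l3"
    then obtain q where "q \<in> POS l3" "subt l3 q = Var x"
      unfolding vars_iff_POS by blast
    then show ?thesis using spine_term_var[OF sp, of q \<nu>] by (auto simp: l3_def)
  qed
  define inst where "inst w x = (if \<exists>q \<in> POS w. x = \<nu> q then subt w (THE q. x = \<nu> q) else Var x)"
    for w :: "(symb, nat) trm" and x
  have inst: "inst w (\<nu> q) = subt w q" if "q \<in> POS w" for w q
    using that by (auto simp: inst_def inj)
  have inst_terms: "inst w \<in> substitutions \<Sigma>" if "w \<in> terms \<Sigma>" for w
    using that by (auto simp: substitutions_def inst_def inj intro: subt_terms)
  have lin: "linear l3"
    unfolding linear_def using spine_term_var[OF sp] inj by (metis l3_def)
  have super: "supertree \<Sigma> l3 u"
  proof -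
    have "subst (inst u) l3 = u"
      unfolding l3_def using spine_POS[OF sp] inst by (auto intro: spine_term_instance spine_refl)
    then show ?thesis using lin inst_terms[OF u] unfolding supertree_def by metis
  qed
  have disj: "vars l3 \<inter> vars l1 = {}" using var_l3 fresh by blast
  have inst_l3: "subst (inst t) l3 = t"
    unfolding l3_def using sp inst by (auto intro: spine_term_instance)
  have inst_t: "subst (inst t) t = t"
  proof -
    have "subst (inst t) t = subst Var t"
      using var_t fresh by (intro subst_cong) (auto simp: inst_def)
    then show ?thesis by (simp add: subst_Var)
  qed
  \<comment> \<open>\<open>inst t\<close> also moves names that are not variables of
    \<open>l3\<close>, which would spoil generality. Restricted to \<open>vars l3\<close> it still
    unifies, and every unifier factors through it with itself as the factor.\<close>
  define \<mu> where "\<mu> x = (if x \<in> vars l3 then inst t x else Var x)" for x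
  have \<mu>_l3: "subst \<mu> l3 = t"
    using inst_l3 subst_cong[of l3 \<mu> "inst t"] by (simp add: \<mu>_def)
  have \<mu>_t: "subst \<mu> t = t"
  proof -
    have "subst \<mu> t = subst Var t"
      using var_t disj by (intro subst_cong) (auto simp: \<mu>_def)
    then show ?thesis by (simp add: subst_Var)
  qed
  have \<mu>: "\<mu> \<in> unifiers \<Sigma> t l3"
    using \<mu>_l3 \<mu>_t inst_terms[OF t] by (auto simp: unifiers_def substitutions_def \<mu>_def)
  have mgu: "is_mgu \<Sigma> \<mu> t l3"
    unfolding is_mgu_def
  proof (intro conjI ballI \<mu>)
    fix \<tau> assume \<tau>: "\<tau> \<in> unifiers \<Sigma> t l3"
    have "\<tau> x = subst \<tau> (\<mu> x)" for x
    proof (cases "x \<in> vars l3")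
      case True
      then obtain q where q: "x = \<nu> q" "q \<in> POS l3" "q \<in> POS t" "subt l3 q = Var x"
        using var_l3 by blast
      have "\<tau> x = subt (subst \<tau> l3) q" using q by (simp add: subt_subst)
      also have "\<dots> = subst \<tau> (subt t q)"
        using \<tau> q by (simp add: unifiers_def subt_subst flip: subt_subst[of q t])
      finally show ?thesis using True q inst by (simp add: \<mu>_def)
    qed (simp add: \<mu>_def)
    then show "\<exists>\<rho> \<in> substitutions \<Sigma>. \<forall>x. \<tau> x = subst \<rho> (\<mu> x)"
      using \<tau> by (auto simp: unifiers_def)
  qed
  have \<gamma>: "\<gamma> \<in> POS l3" "subt l3 \<gamma> = Var (\<nu> \<gamma>)"
    using spine_term_POS[OF sp] spine_term_subt[OF sp] by (auto simp: l3_def)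
  have l3: "l3 \<in> terms \<Sigma>" using spine_term_terms[OF sp u] by (simp add: l3_def)
  have unif: "unifiable \<Sigma> t l3" using \<mu> by (auto simp: unifiable_def)
  have "is_Var (subst \<mu> (subt l3 \<gamma>)) \<or> subst \<mu> (subt l3 \<gamma>) \<in> ground_terms \<Sigma>"
  proof -
    have "supertree \<Sigma> l3 (subt l2 \<beta>) \<and> vars l3 \<inter> vars l1 = {} \<and> (\<alpha> = [] \<or> \<beta> = []) \<and>
        unifiable \<Sigma> (subt r1 \<alpha>) l3 \<and> is_mgu \<Sigma> \<mu> (subt r1 \<alpha>) l3
        \<longrightarrow> is_Var (subt l2 \<beta>) \<or>
            (\<forall>\<gamma> \<in> POS l3. is_Var (subt l2 (\<beta> @ \<gamma>)) \<longrightarrow>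
               is_Var (subst \<mu> (subt l3 \<gamma>)) \<or> subst \<mu> (subt l3 \<gamma>) \<in> ground_terms \<Sigma>)"
      using gsm R1 R2 \<alpha> \<beta> l3 unfolding gsm_trs_def by fast
    then show ?thesis
      using super disj root unif mgu nv v \<gamma>(1) unfolding t_def u_def by blast
  qed
  moreover have "subst \<mu> (subt l3 \<gamma>) = subt t \<gamma>"
    using \<mu>_l3 \<gamma>(1) by (metis subt_subst)
  moreover have "subt t \<gamma> = subt r1 (\<alpha> @ \<gamma>)" using \<alpha> by (simp add: t_def subt_append)
  ultimately show ?thesis by (auto simp: ground_terms_def)
qed

section \<open>Automata whose states are ground terms\<close>

text \<open>An automaton of this kind has a transition \<open>f(s\<^sub>1, \<dots>, s\<^sub>n) \<rightarrow> s\<close> for every state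
  \<open>s = f(s\<^sub>1, \<dots>, s\<^sub>n)\<close>, and a pair \<open>(a, b) \<in> E\<close> stands for the rule \<open>a \<rightarrow> b\<close>. The relation
  \<open>run E \<sigma> l \<eta>\<close> describes a run on \<open>\<sigma>(l)\<close> that assigns the state \<open>\<eta> p\<close> to the position \<open>p\<close>
  and uses no \<open>E\<close>-step at the variables of \<open>l\<close>.\<close>

type_synonym gterm = "(symb, nat) trm"

definition run ::
  "(gterm \<times> gterm) set \<Rightarrow> (nat \<Rightarrow> gterm) \<Rightarrow> gterm \<Rightarrow> (nat list \<Rightarrow> gterm) \<Rightarrow> bool" where
  "run E \<sigma> l \<eta> \<longleftrightarrow> (\<forall>p \<in> POS l. case subt l p of
     Var x \<Rightarrow> \<eta> p = \<sigma> x
   | Fun f ts \<Rightarrow> (Fun f (map (\<lambda>i. \<eta> (p @ [i])) [0..<length ts]), \<eta> p) \<in> E)"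

definition arg_closed :: "('f, 'v) trm set \<Rightarrow> bool" where
  "arg_closed S \<longleftrightarrow> (\<forall>f ts. Fun f ts \<in> S \<longrightarrow> set ts \<subseteq> S)"

lemma arg_closedD: "arg_closed S \<Longrightarrow> Fun f ts \<in> S \<Longrightarrow> t \<in> set ts \<Longrightarrow> t \<in> S"
  by (auto simp: arg_closed_def)

lemma arg_closed_nth: "arg_closed S \<Longrightarrow> Fun f ts \<in> S \<Longrightarrow> i < length ts \<Longrightarrow> ts ! i \<in> S"
  by (auto simp: arg_closed_def subset_iff)

text \<open>The last clause can bind variables without an \<open>E\<close>-step because a step at a
  variable is absorbed into the state bound to it.\<close>

definition saturated ::
  "symb set \<Rightarrow> gterm set \<Rightarrow> (symb, nat) rule set \<Rightarrow> gterm set \<Rightarrow> (gterm \<times> gterm) set \<Rightarrow> bool" where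
  "saturated \<Sigma> L R S E \<longleftrightarrow> finite S \<and> S \<subseteq> ground_terms \<Sigma> \<and> arg_closed S \<and> L \<subseteq> S \<and>
     E \<subseteq> S \<times> S \<and> refl_on S E \<and> trans E \<and>
     (\<forall>(l, r) \<in> R. \<forall>\<sigma> \<eta>. run E \<sigma> l \<eta> \<longrightarrow> (subst \<sigma> r, \<eta> []) \<in> E)"

text \<open>One pair per node suffices: a reflexive and transitive \<open>E\<close> accounts for any
  number of consecutive rules \<open>a \<rightarrow> b\<close>, including none.\<close>

inductive accepts :: "(gterm \<times> gterm) set \<Rightarrow> gterm \<Rightarrow> gterm \<Rightarrow> bool" for E where
  "list_all2 (accepts E) us ss \<Longrightarrow> (Fun f ss, s) \<in> E \<Longrightarrow> accepts E (Fun f us) s"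

lemma accepts_Fun_iff:
  "accepts E (Fun f us) s \<longleftrightarrow> (\<exists>ss. list_all2 (accepts E) us ss \<and> (Fun f ss, s) \<in> E)"
  by (subst accepts.simps) auto

lemma accepts_Var [simp]: "\<not> accepts E (Var x) s"
  by (subst accepts.simps) auto

lemma accepts_mono_state: "accepts E u a \<Longrightarrow> (a, b) \<in> E \<Longrightarrow> trans E \<Longrightarrow> accepts E u b"
  by (cases u) (auto simp: accepts_Fun_iff dest: transD)

lemma run_Var: "run E \<sigma> (Var x) \<eta> \<longleftrightarrow> \<eta> [] = \<sigma> x"
proof -
  have "POS (Var x :: gterm) = {[]}" by auto
  then show ?thesis by (simp add: run_def)
qed

lemma run_Fun:
  "run E \<sigma> (Fun f ts) \<eta> \<longleftrightarrow> (Fun f (map (\<lambda>i. \<eta> [i]) [0..<length ts]), \<eta> []) \<in> E \<and>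
     (\<forall>i<length ts. run E \<sigma> (ts ! i) (\<lambda>p. \<eta> (i # p)))"
proof -
  have "(\<forall>p \<in> POS (Fun f ts). P p) \<longleftrightarrow> P [] \<and> (\<forall>i<length ts. \<forall>p \<in> POS (ts ! i). P (i # p))" for P
    by (auto simp: POS_Fun)
  then show ?thesis by (simp add: run_def cong: trm.case_cong)
qed

lemma run_cong: "run E \<sigma> t \<eta> \<Longrightarrow> (\<And>x. x \<in> vars t \<Longrightarrow> \<sigma> x = \<tau> x) \<Longrightarrow> run E \<tau> t \<eta>"
proof (induction t arbitrary: \<eta>)
  case (Fun f ts)
  have "run E \<tau> (ts ! i) (\<lambda>p. \<eta> (i # p))" if "i < length ts" for i
  proof (rule Fun.IH)
    show "ts ! i \<in> set ts" using that by simp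
    then show "\<sigma> x = \<tau> x" if "x \<in> vars (ts ! i)" for x
      using that by (intro Fun.prems(2)) auto
  qed (use Fun.prems(1) that in \<open>simp add: run_Fun\<close>)
  with Fun.prems(1) show ?case by (simp add: run_Fun)
qed (simp add: run_Var)

lemma run_mono: "run E \<sigma> t \<eta> \<Longrightarrow> E \<subseteq> E' \<Longrightarrow> run E' \<sigma> t \<eta>"
  by (fastforce simp: run_def split: trm.splits)

text \<open>A node below the root is an argument of the source of some pair, and the root is the
  target of one. The latter fails for a variable, whose run uses no pair.\<close>

lemma run_states:
  assumes "run E \<sigma> l \<eta>" "\<not> is_Var l" "E \<subseteq> S \<times> S" "arg_closed S" "p \<in> POS l"
  shows "\<eta> p \<in> S"
  using assms(5)
proof (cases p rule: rev_cases)
  case Nil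
  with assms show ?thesis by (cases l) (auto simp: run_Fun)
next
  case (snoc q i)
  with assms(5) have q: "q \<in> POS l" "[i] \<in> POS (subt l q)" by (auto simp: POS_append)
  then obtain f ts where l: "subt l q = Fun f ts" "i < length ts" by (cases "subt l q") auto
  with q assms(1) have "(Fun f (map (\<lambda>i. \<eta> (q @ [i])) [0..<length ts]), \<eta> q) \<in> E"
    by (force simp: run_def)
  with assms(3) have "Fun f (map (\<lambda>i. \<eta> (q @ [i])) [0..<length ts]) \<in> S" by auto
  then have "set (map (\<lambda>i. \<eta> (q @ [i])) [0..<length ts]) \<subseteq> S"
    using assms(4) unfolding arg_closed_def by blast
  with l(2) snoc show ?thesis by auto
qed

text \<open>Linearity makes the bindings found for the arguments compatible: a variable lies in one
  argument only, so they can be merged.\<close>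

lemma accepts_substE:
  assumes "accepts E (subst \<tau> t) s" "linear t"
  shows "\<exists>\<sigma> \<eta>. run E \<sigma> t \<eta> \<and> \<eta> [] = s \<and> (\<forall>x \<in> vars t. accepts E (\<tau> x) (\<sigma> x))"
  using assms
proof (induction t arbitrary: s)
  case (Var x)
  then show ?case by (intro exI[of _ "\<lambda>_. s"]) (simp add: run_Var)
next
  case (Fun f ts)
  from Fun.prems(1) obtain ss where
    ss: "list_all2 (accepts E) (map (subst \<tau>) ts) ss" "(Fun f ss, s) \<in> E"
    by (auto simp: accepts_Fun_iff)
  then have len: "length ss = length ts" by (auto dest: list_all2_lengthD)
  have "\<exists>\<sigma> \<eta>. run E \<sigma> (ts ! i) \<eta> \<and> \<eta> [] = ss ! i \<and> (\<forall>x \<in> vars (ts ! i). accepts E (\<tau> x) (\<sigma> x))"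
    if "i < length ts" for i
    using Fun.IH[of "ts ! i" "ss ! i"] that ss(1) linear_arg[OF Fun.prems(2)]
    by (auto simp: list_all2_conv_all_nth)
  then obtain \<sigma> \<eta> where
    IH: "\<And>i. i < length ts \<Longrightarrow> run E (\<sigma> i) (ts ! i) (\<eta> i) \<and> \<eta> i [] = ss ! i \<and>
      (\<forall>x \<in> vars (ts ! i). accepts E (\<tau> x) (\<sigma> i x))"
    by metis
  define \<sigma>' where "\<sigma>' x = \<sigma> (THE i. i < length ts \<and> x \<in> vars (ts ! i)) x" for x
  define \<eta>' where "\<eta>' p = (case p of [] \<Rightarrow> s | i # q \<Rightarrow> \<eta> i q)" for p
  have \<sigma>': "\<sigma>' x = \<sigma> i x" if "i < length ts" "x \<in> vars (ts ! i)" for i x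
  proof -
    have "(THE i. i < length ts \<and> x \<in> vars (ts ! i)) = i"
      using that linear_args_disjoint[OF Fun.prems(2)] by blast
    then show ?thesis by (simp add: \<sigma>'_def)
  qed
  have "map (\<lambda>i. \<eta>' [i]) [0..<length ts] = ss"
    using IH len by (auto simp: \<eta>'_def intro!: nth_equalityI)
  moreover have "run E \<sigma>' (ts ! i) (\<lambda>p. \<eta>' (i # p))" if "i < length ts" for i
    using IH[OF that] \<sigma>'[OF that] run_cong[of E "\<sigma> i" "ts ! i" "\<eta> i" \<sigma>'] by (simp add: \<eta>'_def)
  moreover have \<eta>'_Nil: "\<eta>' [] = s" by (simp add: \<eta>'_def)
  ultimately have run: "run E \<sigma>' (Fun f ts) \<eta>'"
    using ss(2) by (simp add: run_Fun)
  have "accepts E (\<tau> x) (\<sigma>' x)" if "x \<in> vars (Fun f ts)" for x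
    using that IH \<sigma>' by (auto simp: in_set_conv_nth)
  with run \<eta>'_Nil show ?case by blast
qed

text \<open>All copies of \<open>x\<close> are read in the same state \<open>\<sigma> x\<close>. The
  instance is itself a state whose arguments are states, so each of its nodes uses its own
  transition and a reflexive pair.\<close>

lemma accepts_substI:
  assumes "\<And>x. x \<in> vars t \<Longrightarrow> accepts E (\<tau> x) (\<sigma> x)"
    and "subst \<sigma> t \<in> S" "arg_closed S" "refl_on S E"
  shows "accepts E (subst \<tau> t) (subst \<sigma> t)"
  using assms(1,2)
proof (induction t)
  case (Fun f ts)
  have "subst \<sigma> t \<in> S" if "t \<in> set ts" for t
    using that Fun.prems(2) by (auto intro: arg_closedD[OF assms(3)])
  then have "accepts E (subst \<tau> t) (subst \<sigma> t)" if "t \<in> set ts" for t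
    using that Fun.IH Fun.prems(1) by auto
  then have "list_all2 (accepts E) (map (subst \<tau>) ts) (map (subst \<sigma>) ts)"
    by (auto simp: list_all2_conv_all_nth)
  then show ?case
    using Fun.prems(2) assms(4) by (auto simp: accepts_Fun_iff dest: refl_onD)
qed simp

lemma accepts_refl: "s \<in> S \<Longrightarrow> vars s = {} \<Longrightarrow> arg_closed S \<Longrightarrow> refl_on S E \<Longrightarrow> accepts E s s"
  using accepts_substI[of s E Var Var S] by (simp add: subst_Var)

text \<open>At a redex, the run on \<open>l\<close> supplies states for the variables, the instance
  of \<open>r\<close> is read in the state \<open>\<sigma>(r)\<close>, and saturation leads from
  there to \<open>s\<close>.\<close>

lemma accepts_rstep:
  assumes sat: "saturated \<Sigma> L R S E" and "trs \<Sigma>' R" "left_linear R"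
    and "rstep R u u'" "accepts E u s"
  shows "accepts E u' s"
  using assms(4,5)
proof (induction arbitrary: s)
  case (root l r \<tau>)
  then have lin: "linear l" and vars: "vars r \<subseteq> vars l"
    using assms(2,3) by (auto simp: left_linear_def trs_def)
  from accepts_substE[OF root.prems lin] obtain \<sigma> \<eta> where
    run: "run E \<sigma> l \<eta>" "\<eta> [] = s" and acc: "\<forall>x \<in> vars l. accepts E (\<tau> x) (\<sigma> x)"
    by blast
  with sat root.hyps have E: "(subst \<sigma> r, s) \<in> E" by (fastforce simp: saturated_def)
  then have "subst \<sigma> r \<in> S" using sat by (auto simp: saturated_def)
  with acc vars sat have "accepts E (subst \<tau> r) (subst \<sigma> r)"
    by (intro accepts_substI[where S = S]) (auto simp: saturated_def)
  with E sat show ?case by (auto simp: saturated_def intro: accepts_mono_state)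
next
  case (arg u v f us vs)
  from arg.prems obtain ss where ss: "list_all2 (accepts E) (us @ u # vs) ss" "(Fun f ss, s) \<in> E"
    by (auto simp: accepts_Fun_iff)
  then obtain ss1 a ss2 where "ss = ss1 @ a # ss2" "list_all2 (accepts E) us ss1" "accepts E u a"
    "list_all2 (accepts E) vs ss2"
    by (auto simp: list_all2_append1 list_all2_Cons1)
  with arg.IH ss(2) show ?case
    by (auto simp: accepts_Fun_iff intro!: exI[of _ ss] list_all2_appendI)
qed

lemma accepts_sound:
  assumes "\<And>a b. (a, b) \<in> E \<Longrightarrow> (rstep R)\<^sup>*\<^sup>* b a" "accepts E u s"
  shows "(rstep R)\<^sup>*\<^sup>* s u"
  using assms(2)
proof (induction)
  case (1 us ss f s)
  then have "list_all2 (rstep R)\<^sup>*\<^sup>* ss us" by (auto simp: list_all2_conv_all_nth)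
  from rstep_args[OF this, of f "[]"] assms(1)[OF 1(2)] show ?case by simp
qed

lemma accepts_ground:
  assumes "saturated \<Sigma> L R S E" "accepts E u s"
  shows "u \<in> ground_terms \<Sigma>"
  using assms(2)
proof (induction)
  case (1 us ss f s)
  then have "Fun f ss \<in> ground_terms \<Sigma>" "length us = length ss" "set us \<subseteq> ground_terms \<Sigma>"
    using assms(1) by (auto simp: saturated_def list_all2_conv_all_nth in_set_conv_nth subset_iff)
  then show ?case by (auto simp: ground_terms_def terms_Fun_iff)
qed

lemma accepts_descendants:
  assumes sat: "saturated \<Sigma> L R S E" and "trs \<Sigma>' R" "left_linear R"
    and sound: "\<And>a b. (a, b) \<in> E \<Longrightarrow> (rstep R)\<^sup>*\<^sup>* b a"
  shows "{u. \<exists>s \<in> L. accepts E u s} = descendants R L"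
proof (intro equalityI subsetI)
  fix u assume "u \<in> {u. \<exists>s \<in> L. accepts E u s}"
  then show "u \<in> descendants R L" using accepts_sound[OF sound] by (auto simp: descendants_def)
next
  fix u assume "u \<in> descendants R L"
  then obtain s where s: "s \<in> L" "(rstep R)\<^sup>*\<^sup>* s u" by (auto simp: descendants_def)
  from s(1) sat have "accepts E s s"
    by (intro accepts_refl[of s S]) (auto simp: saturated_def ground_terms_def)
  with s(2) have "accepts E u s" by (induction) (auto intro: accepts_rstep assms)
  with s(1) show "u \<in> {u. \<exists>s \<in> L. accepts E u s}" by blast
qed

text \<open>The pairs \<open>(a, b)\<close> with \<open>b \<Rightarrow>\<^sup>* a\<close> form a saturated subrelation, so a minimal saturated relation
  is sound.\<close>

lemma saturated_sound_part:
  assumes sat: "saturated \<Sigma> L R S E"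
  shows "saturated \<Sigma> L R S {(a, b) \<in> E. (rstep R)\<^sup>*\<^sup>* b a}" (is "saturated _ _ _ _ ?E")
proof -
  have "(subst \<sigma> r, \<eta> []) \<in> ?E" if lr: "(l, r) \<in> R" and run: "run ?E \<sigma> l \<eta>" for l r \<sigma> \<eta>
  proof -
    \<comment> \<open>A run inside the sound part reads top down as a derivation from the state at
      the root to \<open>\<sigma>(l)\<close>, which one more root step takes to
      \<open>\<sigma>(r)\<close>.\<close>
    have "(rstep R)\<^sup>*\<^sup>* (\<eta> []) (subst \<sigma> l)" if "run ?E \<sigma> l \<eta>" for l \<eta>
      using that
    proof (induction l arbitrary: \<eta>)
      case (Fun f ts)
      have "(rstep R)\<^sup>*\<^sup>* (\<eta> [i]) (subst \<sigma> (ts ! i))" if "i < length ts" for i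
        using Fun.IH[of "ts ! i" "\<lambda>p. \<eta> (i # p)"] Fun.prems that by (simp add: run_Fun)
      then have "list_all2 (rstep R)\<^sup>*\<^sup>* (map (\<lambda>i. \<eta> [i]) [0..<length ts]) (map (subst \<sigma>) ts)"
        by (auto simp: list_all2_conv_all_nth)
      from rstep_args[OF this, of f "[]"] Fun.prems show ?case by (auto simp: run_Fun)
    qed (simp add: run_Var)
    from this[OF run] rstep.root[OF lr] have "(rstep R)\<^sup>*\<^sup>* (\<eta> []) (subst \<sigma> r)"
      by (rule rtranclp.rtrancl_into_rtrancl)
    moreover have "(subst \<sigma> r, \<eta> []) \<in> E"
      using sat lr run_mono[OF run, of E] by (fastforce simp: saturated_def)
    ultimately show ?thesis by simp
  qed
  moreover have "trans ?E"
    using sat by (auto simp: saturated_def trans_def intro: rtranclp_trans)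
  ultimately show ?thesis
    using sat by (auto simp: saturated_def refl_on_def)
qed

section \<open>Existence of a saturated automaton\<close>

lemma subt_snoc: "p \<in> POS t \<Longrightarrow> subt t p = Fun f ts \<Longrightarrow> subt t (p @ [i]) = ts ! i"
  by (simp add: subt_append)

lemma POS_snoc: "p @ [i] \<in> POS t \<longleftrightarrow> p \<in> POS t \<and> (\<exists>f ts. subt t p = Fun f ts \<and> i < length ts)"
  by (cases "subt t p") (auto simp: POS_append)

lemma finite_substs: "finite B \<Longrightarrow> finite {subst \<sigma> t | \<sigma>. \<forall>x \<in> vars t. \<sigma> x \<in> B}"
proof (induction t)
  case (Var x)
  then show ?case by (auto intro: finite_subset[of _ B])
next
  case (Fun f ts)
  define A where "A = (\<Union>t \<in> set ts. {subst \<sigma> t | \<sigma>. \<forall>x \<in> vars t. \<sigma> x \<in> B})"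
  have "finite A" using Fun by (auto simp: A_def)
  then have "finite (Fun f ` {us. set us \<subseteq> A \<and> length us = length ts})"
    by (intro finite_imageI finite_lists_length_eq)
  moreover have "{subst \<sigma> (Fun f ts) | \<sigma>. \<forall>x \<in> vars (Fun f ts). \<sigma> x \<in> B} \<subseteq>
      Fun f ` {us. set us \<subseteq> A \<and> length us = length ts}"
    by (fastforce simp: A_def)
  ultimately show ?case by (rule finite_subset[rotated])
qed

section \<open>The finite set of states built from right-hand sides\<close>

definition binders :: "(symb, nat) rule set \<Rightarrow> gterm set \<Rightarrow> gterm set" where
  "binders R L = {subt t p | t p. t \<in> L \<and> p \<in> POS t} \<union>
     {subt r p | l r p. (l, r) \<in> R \<and> p \<in> POS r \<and> vars (subt r p) = {}}"

text \<open>Subterms of right-hand sides are included so that the states are closed under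
  arguments.\<close>

definition rhs_states :: "(symb, nat) rule set \<Rightarrow> gterm set \<Rightarrow> gterm set" where
  "rhs_states R L = binders R L \<union>
     {subst \<sigma> (subt r p) | \<sigma> l r p. (l, r) \<in> R \<and> p \<in> POS r \<and> (\<forall>x \<in> vars (subt r p). \<sigma> x \<in> binders R L)}"

lemma binders_langI: "t \<in> L \<Longrightarrow> p \<in> POS t \<Longrightarrow> subt t p \<in> binders R L"
  unfolding binders_def by auto

lemma binders_rhsI:
  "(l, r) \<in> R \<Longrightarrow> p \<in> POS r \<Longrightarrow> vars (subt r p) = {} \<Longrightarrow> subt r p \<in> binders R L"
  unfolding binders_def by auto

lemma rhs_statesI:
  "(l, r) \<in> R \<Longrightarrow> p \<in> POS r \<Longrightarrow> \<forall>x \<in> vars (subt r p). \<sigma> x \<in> binders R L \<Longrightarrow>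
     subst \<sigma> (subt r p) \<in> rhs_states R L"
  unfolding rhs_states_def by (intro UnI2 CollectI exI conjI; (rule refl | assumption))

text \<open>The target of an instance of a right-hand side is left arbitrary, so closure under a
  rule reduces to its variables being bound in \<open>binders\<close>.\<close>

definition rhs_eps :: "(symb, nat) rule set \<Rightarrow> gterm set \<Rightarrow> (gterm \<times> gterm) set" where
  "rhs_eps R L = {(a, b) \<in> rhs_states R L \<times> rhs_states R L. a = b \<or>
     (\<exists>l r \<sigma>. (l, r) \<in> R \<and> (\<forall>x \<in> vars r. \<sigma> x \<in> binders R L) \<and> a = subst \<sigma> r)}"

lemma arg_closed_binders: "arg_closed (binders R L)"
  unfolding arg_closed_def
proof (intro allI impI subsetI)
  fix f ts s assume "Fun f ts \<in> binders R L" and s: "s \<in> set ts"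
  from s obtain i where i: "i < length ts" "s = ts ! i" by (auto simp: in_set_conv_nth)
  from \<open>Fun f ts \<in> binders R L\<close> consider
    (lang) t p where "t \<in> L" "p \<in> POS t" "subt t p = Fun f ts"
    | (rhs) l r p where "(l, r) \<in> R" "p \<in> POS r" "vars (subt r p) = {}" "subt r p = Fun f ts"
    unfolding binders_def by (elim UnE CollectE exE conjE) metis+
  then show "s \<in> binders R L"
  proof cases
    case lang
    then have "p @ [i] \<in> POS t" "subt t (p @ [i]) = s"
      using i subt_snoc by (auto simp: POS_snoc)
    with lang show ?thesis using binders_langI by metis
  next
    case rhs
    then have "p @ [i] \<in> POS r" "subt r (p @ [i]) = s" "vars s = {}"
      using i subt_snoc by (auto simp: POS_snoc)
    with rhs show ?thesis using binders_rhsI by metis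
  qed
qed

lemma arg_closed_rhs_states: "arg_closed (rhs_states R L)"
  unfolding arg_closed_def
proof (intro allI impI subsetI)
  fix f ts s assume "Fun f ts \<in> rhs_states R L" and s: "s \<in> set ts"
  then consider "Fun f ts \<in> binders R L"
    | \<sigma> l r p where "(l, r) \<in> R" "p \<in> POS r" "\<forall>x \<in> vars (subt r p). \<sigma> x \<in> binders R L"
        "Fun f ts = subst \<sigma> (subt r p)"
    unfolding rhs_states_def by blast
  then show "s \<in> rhs_states R L"
  proof cases
    case 1
    with s arg_closed_binders show ?thesis by (auto simp: rhs_states_def dest: arg_closedD)
  next
    case 2
    show ?thesis
    proof (cases "subt r p")
      case (Var x)
      with 2 have "Fun f ts \<in> binders R L" by simp
      with s arg_closed_binders show ?thesis by (auto simp: rhs_states_def dest: arg_closedD)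
    next
      case (Fun g us)
      with 2 s obtain i where i: "i < length us" "s = subst \<sigma> (us ! i)"
        by (auto simp: in_set_conv_nth)
      then have "p @ [i] \<in> POS r" "subt r (p @ [i]) = us ! i"
        using 2 Fun subt_snoc by (auto simp: POS_snoc)
      moreover have "\<forall>x \<in> vars (us ! i). \<sigma> x \<in> binders R L"
        using 2 Fun i by auto
      ultimately show ?thesis using 2(1) i(2) rhs_statesI by metis
    qed
  qed
qed

lemma finite_rhs_states:
  assumes "finite R" "finite L"
  shows "finite (rhs_states R L)"
proof -
  have "finite ((\<lambda>(t, p). subt t p) ` (SIGMA t : L. POS t))"
    "finite ((\<lambda>(t, p). subt t p) ` (SIGMA t : snd ` R. POS t))"
    using assms by (auto intro!: finite_imageI finite_SigmaI finite_POS)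
  moreover have "binders R L \<subseteq> (\<lambda>(t, p). subt t p) ` (SIGMA t : L. POS t) \<union>
      (\<lambda>(t, p). subt t p) ` (SIGMA t : snd ` R. POS t)"
    by (force simp: binders_def)
  ultimately have B: "finite (binders R L)" by (blast intro: finite_subset)
  define A where "A = (\<Union>r \<in> snd ` R. \<Union>p \<in> POS r.
    {subst \<sigma> (subt r p) | \<sigma>. \<forall>x \<in> vars (subt r p). \<sigma> x \<in> binders R L})"
  have "finite A" using assms B unfolding A_def by (blast intro: finite_POS finite_substs)
  moreover have "rhs_states R L \<subseteq> binders R L \<union> A"
    unfolding rhs_states_def A_def by force
  ultimately show ?thesis using B by (blast intro: finite_subset)
qed

lemma rhs_states_ground:
  assumes "trs \<Sigma> R" "L \<subseteq> ground_terms \<Sigma>"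
  shows "rhs_states R L \<subseteq> ground_terms \<Sigma>"
proof -
  have B: "binders R L \<subseteq> ground_terms \<Sigma>"
    using assms vars_subt by (fastforce simp: binders_def ground_terms_def trs_def intro: subt_terms)
  have "subst \<sigma> (subt r p) \<in> ground_terms \<Sigma>"
    if "(l, r) \<in> R" "p \<in> POS r" "\<forall>x \<in> vars (subt r p). \<sigma> x \<in> binders R L" for \<sigma> l r p
    using that assms(1) B
    by (fastforce simp: ground_terms_def trs_def vars_subst intro!: subst_terms subt_terms)
  with B show ?thesis unfolding rhs_states_def by blast
qed

text \<open>Follow the run from the root of \<open>l2\<close> down to a variable, and let \<open>\<beta>\<close> be the last position where
  it used an \<open>E\<close>-step (or the root). From there on, \<open>l2\<close> is matched against an instance of a subterm
  of a right-hand side \<open>r1\<close>, so the overlap condition applies.\<close>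

lemma run_binders:
  assumes gsm: "gsm_trs \<Sigma> R" and R2: "(l2, r2) \<in> R" and run: "run (rhs_eps R L) \<sigma> l2 \<eta>"
    and x: "x \<in> vars l2"
  shows "\<sigma> x \<in> binders R L"
proof -
  let ?B = "binders R L"
  \<comment> \<open>The state \<open>s\<close> at \<open>\<pi>\<close> stems from a subterm of
    \<open>r1\<close>: from \<open>\<beta>\<close>, the root or the place of the last proper
    \<open>E\<close>-step, the run has followed \<open>\<gamma>\<close> through \<open>l2\<close>
    and \<open>r1/\<alpha>\<close> alike. Values in \<open>binders\<close> are required only for the
    variables of the subterm reached.\<close>
  define overlap where "overlap \<pi> s l1 r1 \<sigma>1 \<alpha> \<beta> \<gamma> \<longleftrightarrow> (l1, r1) \<in> R \<and> (\<forall>x \<in> vars (subt r1 (\<alpha> @ \<gamma>)). \<sigma>1 x \<in> ?B) \<and> \<alpha> \<in> POS r1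
     \<and> \<beta> \<in> POS l2 \<and> (\<alpha> = [] \<or> \<beta> = []) \<and> \<not> is_Var (subt l2 \<beta>) \<and> spine (subt r1 \<alpha>) (subt l2 \<beta>) \<gamma>
     \<and> \<pi> = \<beta> @ \<gamma> \<and> s = subst \<sigma>1 (subt r1 (\<alpha> @ \<gamma>))" for \<pi> s l1 r1 \<sigma>1 \<alpha> \<beta> \<gamma>
  have nv: "\<not> is_Var l2" using gsm R2 by (auto simp: gsm_trs_def)
  have E: "rhs_eps R L \<subseteq> rhs_states R L \<times> rhs_states R L" by (auto simp: rhs_eps_def)
  have step: "ts ! i \<in> ?B \<or> (\<exists>l1 r1 \<sigma>1 \<alpha> \<beta> \<gamma>. overlap (\<pi> @ [i]) (ts ! i) l1 r1 \<sigma>1 \<alpha> \<beta> \<gamma>)"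
    if inv: "Fun f ts \<in> ?B \<or> (\<exists>l1 r1 \<sigma>1 \<alpha> \<beta> \<gamma>. overlap \<pi> (Fun f ts) l1 r1 \<sigma>1 \<alpha> \<beta> \<gamma>)"
      and \<pi>: "\<pi> \<in> POS l2" "subt l2 \<pi> = Fun f us" "length us = length ts" "i < length ts"
    for f ts us \<pi> i
    using inv
  proof
    assume "Fun f ts \<in> ?B"
    then show ?thesis using \<pi>(4) by (auto dest: arg_closed_nth[OF arg_closed_binders])
  next
    assume "\<exists>l1 r1 \<sigma>1 \<alpha> \<beta> \<gamma>. overlap \<pi> (Fun f ts) l1 r1 \<sigma>1 \<alpha> \<beta> \<gamma>"
    then obtain l1 r1 \<sigma>1 \<alpha> \<beta> \<gamma> where ov: "overlap \<pi> (Fun f ts) l1 r1 \<sigma>1 \<alpha> \<beta> \<gamma>" by blast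
    show ?thesis
    \<comment> \<open>If the path has arrived at a variable of \<open>r1\<close>, the state lies in
      \<open>binders\<close>, and so do all its subterms.\<close>
    proof (cases "subt r1 (\<alpha> @ \<gamma>)")
      case (Var y)
      with ov have "Fun f ts \<in> ?B" by (auto simp: overlap_def)
      then show ?thesis using \<pi>(4) by (auto dest: arg_closed_nth[OF arg_closed_binders])
    next
      case (Fun g vs)
      with ov have vs: "g = f" "ts = map (subst \<sigma>1) vs" by (auto simp: overlap_def)
      have sub: "subt (subt r1 \<alpha>) \<gamma> = Fun f vs" "subt (subt l2 \<beta>) \<gamma> = Fun f us"
        using ov Fun vs \<pi>(2) by (auto simp: overlap_def subt_append)
      with ov vs \<pi> have sp: "spine (subt r1 \<alpha>) (subt l2 \<beta>) (\<gamma> @ [i])"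
        by (auto simp: overlap_def intro: spine_snoc)
      have \<gamma>: "\<gamma> \<in> POS (subt r1 \<alpha>)" using ov spine_POS by (auto simp: overlap_def)
      have "subt r1 (\<alpha> @ \<gamma> @ [i]) = vs ! i"
        using ov sub(1) \<gamma> by (simp add: overlap_def subt_append)
      moreover have "\<forall>x \<in> vars (vs ! i). \<sigma>1 x \<in> ?B"
        using ov Fun vs \<pi>(4) by (auto simp: overlap_def)
      ultimately have "overlap (\<pi> @ [i]) (ts ! i) l1 r1 \<sigma>1 \<alpha> \<beta> (\<gamma> @ [i])"
        using ov sp vs \<pi>(4) by (simp add: overlap_def)
      then show ?thesis by blast
    qed
  qed
  have inv: "\<pi> \<in> POS l2 \<Longrightarrow> \<eta> \<pi> \<in> ?B \<or> (\<exists>l1 r1 \<sigma>1 \<alpha> \<beta> \<gamma>. overlap \<pi> (\<eta> \<pi>) l1 r1 \<sigma>1 \<alpha> \<beta> \<gamma>)" for \<pi>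
  proof (induction \<pi> rule: rev_induct)
    case Nil
    have "\<eta> [] \<in> rhs_states R L"
      using run_states[OF run nv E arg_closed_rhs_states] by simp
    then show ?case
    proof (unfold rhs_states_def, elim UnE CollectE exE conjE)
      fix \<sigma>1 l1 r1 \<alpha> assume "(l1, r1) \<in> R" "\<alpha> \<in> POS r1" "\<forall>x \<in> vars (subt r1 \<alpha>). \<sigma>1 x \<in> ?B"
        "\<eta> [] = subst \<sigma>1 (subt r1 \<alpha>)"
      \<comment> \<open>The two ways to start an overlap mirror condition (i):
        \<open>\<beta> = []\<close> with any \<open>\<alpha>\<close> at the root, and
        \<open>\<alpha> = []\<close> with any \<open>\<beta>\<close> after a proper
        \<open>E\<close>-step.\<close>
      then have "overlap [] (\<eta> []) l1 r1 \<sigma>1 \<alpha> [] []" using nv by (simp add: overlap_def)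
      then show ?thesis by blast
    qed simp
  next
    case (snoc i \<pi>)
    then obtain f us where us: "\<pi> \<in> POS l2" "subt l2 \<pi> = Fun f us" "i < length us"
      by (auto simp: POS_snoc)
    define ts where "ts = map (\<lambda>i. \<eta> (\<pi> @ [i])) [0..<length us]"
    have ts: "(Fun f ts, \<eta> \<pi>) \<in> rhs_eps R L"
      using run us by (force simp: run_def ts_def)
    have "Fun f ts \<in> ?B \<or> (\<exists>l1 r1 \<sigma>1 \<alpha> \<beta> \<gamma>. overlap \<pi> (Fun f ts) l1 r1 \<sigma>1 \<alpha> \<beta> \<gamma>)"
    proof (cases "Fun f ts = \<eta> \<pi>")
      case True
      then show ?thesis using snoc.IH[OF us(1)] by simp
    next
      case False
      with ts obtain l1 r1 \<sigma>1 where "(l1, r1) \<in> R" "\<forall>x \<in> vars r1. \<sigma>1 x \<in> ?B"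
        "Fun f ts = subst \<sigma>1 r1"
        by (auto simp: rhs_eps_def)
      then have "overlap \<pi> (Fun f ts) l1 r1 \<sigma>1 [] \<pi> []" using us by (simp add: overlap_def)
      then show ?thesis by blast
    qed
    from step[OF this us(1,2), of i] us(3) show ?case by (simp add: ts_def)
  qed
  from x obtain \<pi> where \<pi>: "\<pi> \<in> POS l2" "subt l2 \<pi> = Var x" by (auto simp: vars_iff_POS)
  with run have \<eta>: "\<eta> \<pi> = \<sigma> x" by (force simp: run_def)
  from inv[OF \<pi>(1)] show ?thesis
  proof
    assume "\<exists>l1 r1 \<sigma>1 \<alpha> \<beta> \<gamma>. overlap \<pi> (\<eta> \<pi>) l1 r1 \<sigma>1 \<alpha> \<beta> \<gamma>"
    then obtain l1 r1 \<sigma>1 \<alpha> \<beta> \<gamma> where ov: "overlap \<pi> (\<eta> \<pi>) l1 r1 \<sigma>1 \<alpha> \<beta> \<gamma>" by blast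
    \<comment> \<open>At a variable of \<open>l2\<close> two cases remain: a variable of
      \<open>r1\<close>, whose value lies in \<open>binders\<close>, or a ground subterm of
      \<open>r1\<close>, and these belong to \<open>binders\<close> by construction.\<close>
    then have "is_Var (subt r1 (\<alpha> @ \<gamma>)) \<or> vars (subt r1 (\<alpha> @ \<gamma>)) = {}"
      using gsm_overlap[OF gsm _ R2, of l1 r1 \<alpha> \<beta> \<gamma>] \<pi>(2) by (auto simp: overlap_def)
    then show ?thesis
    proof
      assume "is_Var (subt r1 (\<alpha> @ \<gamma>))"
      with ov show ?thesis using \<eta> by (cases "subt r1 (\<alpha> @ \<gamma>)") (auto simp: overlap_def)
    next
      assume ground: "vars (subt r1 (\<alpha> @ \<gamma>)) = {}"
      then have "\<sigma> x = subt r1 (\<alpha> @ \<gamma>)"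
        using ov \<eta> subst_cong[of "subt r1 (\<alpha> @ \<gamma>)" \<sigma>1 Var] by (simp add: overlap_def subst_Var)
      moreover have "\<alpha> @ \<gamma> \<in> POS r1"
        using ov spine_POS by (auto simp: overlap_def POS_append)
      moreover have "(l1, r1) \<in> R" using ov by (simp add: overlap_def)
      ultimately show ?thesis using ground binders_rhsI by metis
    qed
  qed (simp add: \<eta>)
qed

text \<open>Two alphabets, because overlaps are judged over the alphabet of the GSM condition, while
  the states contain the symbols of the input language.\<close>

lemma saturated_rhs_eps:
  assumes "gsm_trs \<Sigma> R" "trs \<Sigma>' R" "finite L" "L \<subseteq> ground_terms \<Sigma>'"
  shows "saturated \<Sigma>' L R (rhs_states R L) (rhs_eps R L)"
proof -
  have "(subst \<sigma> r, \<eta> []) \<in> rhs_eps R L" if lr: "(l, r) \<in> R" and run: "run (rhs_eps R L) \<sigma> l \<eta>"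
    for l r \<sigma> \<eta>
  proof -
    have "vars r \<subseteq> vars l" using lr assms(2) by (auto simp: trs_def)
    then have B: "\<forall>x \<in> vars r. \<sigma> x \<in> binders R L"
      using run_binders[OF assms(1) lr run] by blast
    have nv: "\<not> is_Var l" using assms(1) lr by (auto simp: gsm_trs_def)
    have E: "rhs_eps R L \<subseteq> rhs_states R L \<times> rhs_states R L" by (auto simp: rhs_eps_def)
    have "subst \<sigma> (subt r []) \<in> rhs_states R L"
      using lr B by (intro rhs_statesI) auto
    moreover have "\<eta> [] \<in> rhs_states R L"
      using run_states[OF run nv E arg_closed_rhs_states] by simp
    ultimately show ?thesis using lr B unfolding rhs_eps_def by fastforce
  qed
  then have "\<forall>(l, r) \<in> R. \<forall>\<sigma> \<eta>. run (rhs_eps R L) \<sigma> l \<eta> \<longrightarrow> (subst \<sigma> r, \<eta> []) \<in> rhs_eps R L"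
    by blast
  moreover have "L \<subseteq> rhs_states R L"
  proof
    fix t assume "t \<in> L"
    then have "subt t [] \<in> binders R L" by (intro binders_langI) auto
    then show "t \<in> rhs_states R L" by (simp add: rhs_states_def)
  qed
  \<comment> \<open>A nontrivial pair starts at an instance of a right-hand side, which is related
    to all states.\<close>
  moreover have "trans (rhs_eps R L)" unfolding trans_def rhs_eps_def by blast
  moreover have "refl_on (rhs_states R L) (rhs_eps R L)"
    by (auto simp: refl_on_def rhs_eps_def)
  moreover have "finite (rhs_states R L)"
    using assms by (intro finite_rhs_states) (auto simp: trs_def)
  moreover have "rhs_eps R L \<subseteq> rhs_states R L \<times> rhs_states R L"
    by (auto simp: rhs_eps_def)
  ultimately show ?thesis
    unfolding saturated_def
    using rhs_states_ground[OF assms(2,4)] arg_closed_rhs_states by (intro conjI)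
qed

section \<open>Recursive functions\<close>

text \<open>Fixing the arity leaves \<open>F\<close> arbitrary on lists of other lengths, so
  \<open>nth\<close>, \<open>hd\<close> and \<open>tl\<close> can be used freely.\<close>

definition recursive :: "nat \<Rightarrow> (nat list \<Rightarrow> nat) \<Rightarrow> bool" where
  "recursive n F \<longleftrightarrow> (\<exists>e. \<forall>xs. length xs = n \<longrightarrow> computes e xs (F xs))"

lemma recursive_cong:
  "recursive n F \<Longrightarrow> (\<And>xs. length xs = n \<Longrightarrow> F xs = G xs) \<Longrightarrow> recursive n G"
  by (auto simp: recursive_def)

lemma recursive_proj: "i < n \<Longrightarrow> recursive n (\<lambda>xs. xs ! i)"
  unfolding recursive_def by (auto intro!: exI[of _ "Proj i"] computes.Proj)

lemma recursive_zero: "recursive n (\<lambda>xs. 0)"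
  unfolding recursive_def by (auto intro!: exI[of _ Zero] computes.Zero)

lemma recursive_comp:
  assumes "recursive (length Gs) F" "\<And>G. G \<in> set Gs \<Longrightarrow> recursive n G"
  shows "recursive n (\<lambda>xs. F (map (\<lambda>G. G xs) Gs))"
proof -
  from assms(1) obtain f where f: "\<And>xs. length xs = length Gs \<Longrightarrow> computes f xs (F xs)"
    by (auto simp: recursive_def)
  from assms(2) obtain g where
    g: "\<And>G xs. G \<in> set Gs \<Longrightarrow> length xs = n \<Longrightarrow> computes (g G) xs (G xs)"
    unfolding recursive_def by metis
  have "computes (Comp f (map g Gs)) xs (F (map (\<lambda>G. G xs) Gs))" if "length xs = n" for xs
  proof (rule computes.Comp)
    show "list_all2 (\<lambda>g. computes g xs) (map g Gs) (map (\<lambda>G. G xs) Gs)"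
      using g that by (auto simp: list_all2_conv_all_nth)
  qed (simp add: f)
  then show ?thesis unfolding recursive_def by blast
qed

lemma recursive_comp1:
  assumes "recursive 1 (\<lambda>xs. f (xs ! 0))" "recursive n G"
  shows "recursive n (\<lambda>xs. f (G xs))"
  using recursive_comp[of "[G]" "\<lambda>xs. f (xs ! 0)"] assms by simp

lemma recursive_comp2:
  assumes "recursive 2 (\<lambda>xs. f (xs ! 0) (xs ! 1))" "recursive n G" "recursive n H"
  shows "recursive n (\<lambda>xs. f (G xs) (H xs))"
  using recursive_comp[of "[G, H]" "\<lambda>xs. f (xs ! 0) (xs ! 1)" n] assms
  by (auto simp: numeral_2_eq_2)

lemma recursive_primrec:
  assumes "recursive n G" "recursive (Suc (Suc n)) H"
  shows "recursive (Suc n) (\<lambda>xs. rec_nat (G (tl xs)) (\<lambda>m y. H (m # y # tl xs)) (hd xs))"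
proof -
  from assms obtain g h where g: "\<And>xs. length xs = n \<Longrightarrow> computes g xs (G xs)"
    and h: "\<And>xs. length xs = Suc (Suc n) \<Longrightarrow> computes h xs (H xs)"
    by (auto simp: recursive_def)
  have "computes (PrimRec g h) (m # xs) (rec_nat (G xs) (\<lambda>m y. H (m # y # xs)) m)"
    if "length xs = n" for m xs
    by (induction m) (auto intro!: computes.PrimRec_0 computes.PrimRec_Suc[OF _ h] g simp: that)
  then show ?thesis
    unfolding recursive_def by (auto simp: length_Suc_conv intro!: exI[of _ "PrimRec g h"])
qed

lemma recursive_Suc: "recursive n G \<Longrightarrow> recursive n (\<lambda>xs. Suc (G xs))"
proof (rule recursive_comp1[where f = Suc])
  show "recursive 1 (\<lambda>xs. Suc (xs ! 0))"
    unfolding recursive_def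
    by (auto simp: length_Suc_conv intro!: exI[of _ Succ] computes.Succ)
qed

lemma recursive_const: "recursive n (\<lambda>xs. k)"
  by (induction k) (auto intro: recursive_zero recursive_Suc)

lemma recursive_nat1:
  assumes h: "recursive 2 (\<lambda>xs. h (xs ! 0) (xs ! 1))" and f: "\<And>n. f (Suc n) = h n (f n)"
  shows "recursive 1 (\<lambda>xs. f (xs ! 0))"
proof (rule recursive_cong)
  show "recursive 1 (\<lambda>xs. rec_nat (f 0) (\<lambda>m y. h ((m # y # tl xs) ! 0) ((m # y # tl xs) ! 1)) (hd xs))"
    using recursive_primrec[of 0 "\<lambda>_. f 0" "\<lambda>xs. h (xs ! 0) (xs ! 1)"] h
    by (simp add: recursive_const numeral_2_eq_2)
  show "rec_nat (f 0) (\<lambda>m y. h ((m # y # tl xs) ! 0) ((m # y # tl xs) ! 1)) (hd xs) = f (xs ! 0)"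
    if "length xs = 1" for xs
  proof -
    have "rec_nat (f 0) h m = f m" for m by (induction m) (simp_all add: f)
    then show ?thesis using that by (cases xs) auto
  qed
qed

lemma recursive_nat2:
  assumes g: "recursive 1 (\<lambda>xs. g (xs ! 0))"
    and h: "recursive 3 (\<lambda>xs. h (xs ! 0) (xs ! 1) (xs ! 2))"
    and f: "\<And>x. f 0 x = g x" "\<And>n x. f (Suc n) x = h n (f n x) x"
  shows "recursive 2 (\<lambda>xs. f (xs ! 0) (xs ! 1))"
proof (rule recursive_cong)
  let ?F = "\<lambda>xs. rec_nat (g (tl xs ! 0))
    (\<lambda>m y. h ((m # y # tl xs) ! 0) ((m # y # tl xs) ! 1) ((m # y # tl xs) ! 2)) (hd xs)"
  show "recursive 2 ?F"
    using recursive_primrec[OF g, of "\<lambda>xs. h (xs ! 0) (xs ! 1) (xs ! 2)"] h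
    by (simp add: numeral_2_eq_2 numeral_3_eq_3)
  show "?F xs = f (xs ! 0) (xs ! 1)" if "length xs = 2" for xs
  proof -
    have "rec_nat (g x) (\<lambda>m y. h m y x) m = f m x" for m x by (induction m) (simp_all add: f)
    then show ?thesis using that by (auto simp: length_Suc_conv numeral_2_eq_2)
  qed
qed

section \<open>Primitive recursive arithmetic on codes\<close>

lemma recursive_add: "recursive n G \<Longrightarrow> recursive n H \<Longrightarrow> recursive n (\<lambda>xs. G xs + H xs)"
proof (rule recursive_comp2[where f = "(+)"])
  show "recursive 2 (\<lambda>xs. xs ! 0 + xs ! 1)"
  proof (rule recursive_nat2[where f = "(+)" and g = "\<lambda>x. x" and h = "\<lambda>_ y _. Suc y"])
    show "recursive 3 (\<lambda>xs. Suc (xs ! 1))" by (intro recursive_Suc recursive_proj) simp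
  qed (auto intro: recursive_proj)
qed

lemma recursive_diff: "recursive n G \<Longrightarrow> recursive n H \<Longrightarrow> recursive n (\<lambda>xs. G xs - H xs)"
\<comment> \<open>Recursion runs on the first argument, so the subtrahend has to come first.\<close>
proof (rule recursive_comp2[where f = "\<lambda>y x. x - y" and G = H and H = G])
  have pred: "recursive 1 (\<lambda>xs. (\<lambda>x. x - 1) (xs ! 0))"
    by (rule recursive_nat1[where h = "\<lambda>n _. n"]) (auto intro: recursive_proj)
  show "recursive 2 (\<lambda>xs. xs ! 1 - xs ! 0)"
  proof (rule recursive_nat2[where f = "\<lambda>y x. x - y" and g = "\<lambda>x. x" and h = "\<lambda>_ y _. y - 1"])
    show "recursive 3 (\<lambda>xs. xs ! 1 - 1)"
      using recursive_comp1[where f = "\<lambda>x. x - 1", OF pred, of 3 "\<lambda>xs. xs ! 1"]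
      by (simp add: recursive_proj)
  qed (auto intro: recursive_proj)
qed

lemma recursive_triangle: "recursive n G \<Longrightarrow> recursive n (\<lambda>xs. triangle (G xs))"
proof (rule recursive_comp1[where f = triangle])
  show "recursive 1 (\<lambda>xs. triangle (xs ! 0))"
  proof (rule recursive_nat1[where h = "\<lambda>m y. y + Suc m"])
    show "recursive 2 (\<lambda>xs. xs ! 1 + Suc (xs ! 0))"
      by (intro recursive_add recursive_Suc recursive_proj) simp_all
  qed simp
qed

lemma recursive_prod_encode:
  "recursive n G \<Longrightarrow> recursive n H \<Longrightarrow> recursive n (\<lambda>xs. prod_encode (G xs, H xs))"
  unfolding prod_encode_def prod.case by (intro recursive_add recursive_triangle)

lemma recursive_mod2: "recursive n G \<Longrightarrow> recursive n (\<lambda>xs. G xs mod 2)"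
proof (rule recursive_comp1[where f = "\<lambda>x. x mod 2"])
  show "recursive 1 (\<lambda>xs. xs ! 0 mod 2)"
  proof (rule recursive_nat1[where h = "\<lambda>_ y. 1 - y"])
    show "Suc n mod 2 = 1 - n mod 2" for n by presburger
    show "recursive 2 (\<lambda>xs. 1 - xs ! 1)"
      by (intro recursive_diff recursive_const recursive_proj) simp
  qed
qed

lemma recursive_div2: "recursive n G \<Longrightarrow> recursive n (\<lambda>xs. G xs div 2)"
proof (rule recursive_comp1[where f = "\<lambda>x. x div 2"])
  show "recursive 1 (\<lambda>xs. xs ! 0 div 2)"
  proof (rule recursive_nat1[where h = "\<lambda>m y. y + m mod 2"])
    show "Suc n div 2 = n div 2 + n mod 2" for n by presburger
    show "recursive 2 (\<lambda>xs. xs ! 1 + xs ! 0 mod 2)"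
      by (intro recursive_add recursive_mod2 recursive_proj) simp_all
  qed
qed

text \<open>Membership in \<open>set_decode\<close> is the parity of such a quotient, so iterated
  halving decides it.\<close>

lemma recursive_shift: "recursive n G \<Longrightarrow> recursive n H \<Longrightarrow> recursive n (\<lambda>xs. H xs div 2 ^ G xs)"
proof (rule recursive_comp2[where f = "\<lambda>m x. x div 2 ^ m"])
  show "recursive 2 (\<lambda>xs. xs ! 1 div 2 ^ (xs ! 0))"
  proof (rule recursive_nat2[where f = "\<lambda>m x. x div 2 ^ m" and g = "\<lambda>x. x" and h = "\<lambda>_ y _. y div 2"])
    show "recursive 3 (\<lambda>xs. xs ! 1 div 2)" by (intro recursive_div2 recursive_proj) simp
    show "x div 2 ^ Suc m = x div 2 ^ m div 2" for m x :: nat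
      by (simp add: div_mult2_eq[of x "2 ^ m" 2, symmetric] mult.commute)
  qed (auto intro: recursive_proj)
qed

lemma recursive_sgn: "recursive n G \<Longrightarrow> recursive n (\<lambda>xs. if G xs = 0 then 0 else 1)"
proof (rule recursive_comp1[where f = "\<lambda>x. if x = 0 then 0 else 1"])
  show "recursive 1 (\<lambda>xs. if xs ! 0 = 0 then 0 else 1)"
    by (rule recursive_nat1[where h = "\<lambda>_ _. 1"]) (auto intro: recursive_const)
qed

subsection \<open>Bounded formulas\<close>

text \<open>Just enough to express the codes: \<open>Pr\<close> is the pairing, while doubling and
  successor give the two branches of \<open>sum_encode\<close>.\<close>

datatype expr = V nat | Cst nat | Sc expr | Db expr | Pr expr expr

datatype form = Eq expr expr | Mem expr expr | Neg form | And form form | Forall nat expr form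

primrec evl :: "(nat \<Rightarrow> nat) \<Rightarrow> expr \<Rightarrow> nat" where
  "evl \<rho> (V i) = \<rho> i"
| "evl \<rho> (Cst k) = k"
| "evl \<rho> (Sc a) = Suc (evl \<rho> a)"
| "evl \<rho> (Db a) = 2 * evl \<rho> a"
| "evl \<rho> (Pr a b) = prod_encode (evl \<rho> a, evl \<rho> b)"

primrec sat :: "(nat \<Rightarrow> nat) \<Rightarrow> form \<Rightarrow> bool" where
  "sat \<rho> (Eq a b) \<longleftrightarrow> evl \<rho> a = evl \<rho> b"
| "sat \<rho> (Mem a b) \<longleftrightarrow> evl \<rho> a \<in> set_decode (evl \<rho> b)"
| "sat \<rho> (Neg \<phi>) \<longleftrightarrow> \<not> sat \<rho> \<phi>"
| "sat \<rho> (And \<phi> \<psi>) \<longleftrightarrow> sat \<rho> \<phi> \<and> sat \<rho> \<psi>"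
| "sat \<rho> (Forall i a \<phi>) \<longleftrightarrow> (\<forall>y < evl \<rho> a. sat (\<rho>(i := y)) \<phi>)"

text \<open>The default 0 lets a formula use names beyond the inputs, to be set by its
  quantifiers.\<close>

definition env :: "nat list \<Rightarrow> nat \<Rightarrow> nat" where
  "env xs i = (if i < length xs then xs ! i else 0)"

lemma recursive_env: "recursive n (\<lambda>xs. env xs i)"
proof (cases "i < n")
  case True
  then show ?thesis by (auto intro: recursive_cong[OF recursive_proj] simp: env_def)
next
  case False
  then show ?thesis by (auto intro: recursive_cong[OF recursive_zero] simp: env_def)
qed

lemma recursive_evl: "recursive n (\<lambda>xs. evl (env xs) a)"
proof (induction a)
  case (Db a)
  then show ?case by (auto intro: recursive_cong[OF recursive_add[OF Db Db]])
qed (auto intro: recursive_env recursive_const recursive_Suc recursive_prod_encode)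

text \<open>Truth is represented by \<open>0\<close>, since \<open>Mu\<close> searches for zeros.\<close>

lemma recursive_sat: "recursive n (\<lambda>xs. if sat (env xs) \<phi> then 0 else 1)"
proof (induction \<phi> arbitrary: n)
  case (Eq a b)
  let ?F = "\<lambda>xs. (evl (env xs) a - evl (env xs) b) + (evl (env xs) b - evl (env xs) a)"
  have "recursive n (\<lambda>xs. if ?F xs = 0 then 0 else 1)"
    by (intro recursive_sgn recursive_add recursive_diff recursive_evl)
  then show ?case by (rule recursive_cong) auto
next
  case (Mem a b)
  have "recursive n (\<lambda>xs. 1 - evl (env xs) b div 2 ^ evl (env xs) a mod 2)"
    by (intro recursive_diff recursive_mod2 recursive_const recursive_shift recursive_evl)
  then show ?case by (rule recursive_cong) (auto simp: set_decode_def odd_iff_mod_2_eq_one)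
next
  case (Neg \<phi>)
  have "recursive n (\<lambda>xs. 1 - (if sat (env xs) \<phi> then 0 else 1))"
    by (intro recursive_diff recursive_const Neg)
  then show ?case by (rule recursive_cong) auto
next
  case (And \<phi> \<psi>)
  let ?F = "\<lambda>xs. (if sat (env xs) \<phi> then 0 else 1) + (if sat (env xs) \<psi> then 0 else 1 :: nat)"
  have "recursive n (\<lambda>xs. if ?F xs = 0 then 0 else 1)"
    by (intro recursive_sgn recursive_add And)
  then show ?case by (rule recursive_cong) auto
next
  case (Forall i a \<phi>)
  \<comment> \<open>The quantified name \<open>i\<close> may lie beyond the \<open>n\<close> inputs.
    A list of length \<open>K\<close> has room for it, and padding with 0 does not change
    \<open>env\<close>.\<close>
  define K where "K = max n (Suc i)"
  define Gs where "Gs = map (\<lambda>j zs. if j = i then zs ! 0 else env (tl zs) j) [0..<K]"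
  define P where "P zs = (if sat (env (map (\<lambda>G. G zs) Gs)) \<phi> then 0 else 1 :: nat)" for zs
  have "recursive (Suc n) (\<lambda>zs. if j = i then zs ! 0 else env (tl zs) j)" for j
  proof -
    have "recursive (Suc n) (\<lambda>zs. if j = i then zs ! 0 else env zs (Suc j))"
      by (cases "j = i") (auto intro: recursive_proj recursive_env)
    then show ?thesis by (rule recursive_cong) (auto simp: length_Suc_conv env_def)
  qed
  then have P: "recursive (Suc n) P"
    unfolding P_def by (intro recursive_comp[where F = "\<lambda>xs. if sat (env xs) \<phi> then 0 else 1"] Forall)
      (auto simp: Gs_def)
  have P_iff: "P (y # xs) = 0 \<longleftrightarrow> sat ((env xs)(i := y)) \<phi>" if "length xs = n" for y xs
  proof -
    have "env (map (\<lambda>G. G (y # xs)) Gs) = (env xs)(i := y)"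
      using that by (auto simp: fun_eq_iff env_def Gs_def K_def simp del: upt_Suc)
    then show ?thesis by (simp add: P_def)
  qed
  \<comment> \<open>With 0 for truth, conjunction is a sum cut back to 0 or 1; \<open>B\<close>
    iterates it over all values below the bound.\<close>
  define H where "H zs = (if zs ! 1 + P (zs ! 0 # tl (tl zs)) = 0 then 0 else 1 :: nat)" for zs
  define B where "B zs = rec_nat 0 (\<lambda>m y. H (m # y # tl zs)) (hd zs)" for zs
  have "recursive (Suc (Suc n)) (\<lambda>zs. P (zs ! 0 # tl (tl zs)))"
  proof (rule recursive_cong)
    show "recursive (Suc (Suc n)) (\<lambda>zs. P (map (\<lambda>G. G zs)
        ((\<lambda>zs. zs ! 0) # map (\<lambda>j zs. zs ! Suc (Suc j)) [0..<n])))"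
      by (rule recursive_comp) (auto simp: P intro: recursive_proj)
    show "P (map (\<lambda>G. G zs) ((\<lambda>zs. zs ! 0) # map (\<lambda>j zs. zs ! Suc (Suc j)) [0..<n])) =
        P (zs ! 0 # tl (tl zs))" if "length zs = Suc (Suc n)" for zs
    proof -
      have "map (\<lambda>j. zs ! Suc (Suc j)) [0..<n] = tl (tl zs)"
        using that by (auto simp: nth_tl intro!: nth_equalityI)
      then show ?thesis by (simp add: comp_def)
    qed
  qed
  then have "recursive (Suc (Suc n)) H"
    unfolding H_def by (intro recursive_sgn recursive_add recursive_proj) auto
  then have B: "recursive (Suc n) B"
    unfolding B_def by (intro recursive_primrec[where G = "\<lambda>_. 0"] recursive_zero)
  have B_eq: "B (b # xs) = (if \<forall>y<b. sat ((env xs)(i := y)) \<phi> then 0 else 1)"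
    if "length xs = n" for b xs
    using P_iff[OF that] by (induction b) (auto simp: B_def H_def less_Suc_eq)
  show ?case
  proof (rule recursive_cong)
    show "recursive n (\<lambda>xs. B (map (\<lambda>G. G xs)
        ((\<lambda>xs. evl (env xs) a) # map (\<lambda>j xs. xs ! j) [0..<n])))"
      by (rule recursive_comp) (auto simp: B intro: recursive_proj recursive_evl)
    show "B (map (\<lambda>G. G xs) ((\<lambda>xs. evl (env xs) a) # map (\<lambda>j xs. xs ! j) [0..<n])) =
        (if sat (env xs) (Forall i a \<phi>) then 0 else 1)" if "length xs = n" for xs
    proof -
      have "map (\<lambda>j. xs ! j) [0..<n] = xs" using that by (auto intro: nth_equalityI)
      then show ?thesis using B_eq[OF that] by (simp add: comp_def)
    qed
  qed
qed

text \<open>\<open>Mu\<close> puts the candidate first, hence the name 0 for the unknown. The tested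
  truth value is total, so the search stops as soon as a solution exists.\<close>

lemma computes_search:
  "\<exists>e. \<forall>xs. length xs = n \<and> (\<exists>m. sat (env (m # xs)) \<phi>) \<longrightarrow>
     (\<exists>m. computes e xs m \<and> sat (env (m # xs)) \<phi>)"
proof -
  obtain f where f: "\<And>xs. length xs = Suc n \<Longrightarrow> computes f xs (if sat (env xs) \<phi> then 0 else 1)"
    using recursive_sat[of "Suc n" \<phi>] by (auto simp: recursive_def)
  have "\<exists>m. computes (Mu f) xs m \<and> sat (env (m # xs)) \<phi>"
    if xs: "length xs = n" and ex: "\<exists>m. sat (env (m # xs)) \<phi>" for xs
  proof (intro exI conjI)
    let ?m = "LEAST m. sat (env (m # xs)) \<phi>"
    show m: "sat (env (?m # xs)) \<phi>" using ex by (rule LeastI_ex)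
    show "computes (Mu f) xs ?m"
    proof (rule computes.Mu)
      show "computes f (?m # xs) 0" using f[of "?m # xs"] m xs by simp
      show "\<exists>y>0. computes f (m # xs) y" if "m < ?m" for m
        using f[of "m # xs"] not_less_Least[OF that] xs by (auto intro!: exI[of _ 1])
    qed
  qed
  then show ?thesis by blast
qed

section \<open>Derived connectives and quantifiers over coded sets\<close>

definition Or :: "form \<Rightarrow> form \<Rightarrow> form" where
  "Or \<phi> \<psi> = Neg (And (Neg \<phi>) (Neg \<psi>))"

definition Imp :: "form \<Rightarrow> form \<Rightarrow> form" where
  "Imp \<phi> \<psi> = Neg (And \<phi> (Neg \<psi>))"

definition Exists :: "nat \<Rightarrow> expr \<Rightarrow> form \<Rightarrow> form" where
  "Exists i a \<phi> = Neg (Forall i a (Neg \<phi>))"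

definition AllIn :: "nat \<Rightarrow> nat \<Rightarrow> form \<Rightarrow> form" where
  "AllIn i j \<phi> = Forall i (V j) (Imp (Mem (V i) (V j)) \<phi>)"

definition ExIn :: "nat \<Rightarrow> nat \<Rightarrow> form \<Rightarrow> form" where
  "ExIn i j \<phi> = Exists i (V j) (And (Mem (V i) (V j)) \<phi>)"

definition Conj :: "form list \<Rightarrow> form" where
  "Conj \<phi>s = foldr And \<phi>s (Eq (Cst 0) (Cst 0))"

text \<open>The bit of \<open>x\<close> alone contributes \<open>2 ^ x\<close>, which exceeds
  \<open>x\<close>. Therefore the code of a set bounds the quantifiers over its elements.\<close>

lemma set_decode_less: "x \<in> set_decode A \<Longrightarrow> x < A"
proof -
  assume "x \<in> set_decode A"
  then have "odd (A div 2 ^ x)" by (simp add: set_decode_def)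
  then have "A div 2 ^ x \<noteq> 0" by (metis even_zero)
  then have "2 ^ x \<le> A" by (auto simp: div_eq_0_iff not_less)
  then show ?thesis using less_exp[of x] by linarith
qed

lemma sat_derived [simp]:
  "sat \<rho> (Or \<phi> \<psi>) \<longleftrightarrow> sat \<rho> \<phi> \<or> sat \<rho> \<psi>"
  "sat \<rho> (Imp \<phi> \<psi>) \<longleftrightarrow> (sat \<rho> \<phi> \<longrightarrow> sat \<rho> \<psi>)"
  "sat \<rho> (Exists i a \<phi>) \<longleftrightarrow> (\<exists>y < evl \<rho> a. sat (\<rho>(i := y)) \<phi>)"
  by (auto simp: Or_def Imp_def Exists_def)

lemma sat_AllIn [simp]:
  "i \<noteq> j \<Longrightarrow> sat \<rho> (AllIn i j \<phi>) \<longleftrightarrow> (\<forall>y \<in> set_decode (\<rho> j). sat (\<rho>(i := y)) \<phi>)"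
  by (auto simp: AllIn_def dest: set_decode_less)

lemma sat_ExIn [simp]:
  "i \<noteq> j \<Longrightarrow> sat \<rho> (ExIn i j \<phi>) \<longleftrightarrow> (\<exists>y \<in> set_decode (\<rho> j). sat (\<rho>(i := y)) \<phi>)"
  by (auto simp: ExIn_def dest: set_decode_less)

lemma sat_Conj [simp]: "sat \<rho> (Conj \<phi>s) \<longleftrightarrow> (\<forall>\<phi> \<in> set \<phi>s. sat \<rho> \<phi>)"
  by (induction \<phi>s) (auto simp: Conj_def)

text \<open>A block of quantifiers amounts to one choice of values for all its names. With
  \<open>j\<close> outside the block, the range stays fixed throughout.\<close>

lemma sat_AllIns:
  assumes "j \<notin> set js"
  shows "sat \<rho> (foldr (\<lambda>i. AllIn i j) js \<phi>) \<longleftrightarrow>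
    (\<forall>\<rho>'. (\<forall>i. i \<notin> set js \<longrightarrow> \<rho>' i = \<rho> i) \<and> (\<forall>i \<in> set js. \<rho>' i \<in> set_decode (\<rho> j)) \<longrightarrow> sat \<rho>' \<phi>)"
  using assms
proof (induction js arbitrary: \<rho>)
  case Nil
  have "(\<forall>i. \<rho>' i = \<rho> i) \<longleftrightarrow> \<rho>' = \<rho>" for \<rho>' by auto
  then show ?case by simp
next
  case (Cons i js)
  show ?case (is "?L \<longleftrightarrow> ?R")
  proof
    assume ?L
    then have L: "sat (\<rho>(i := y)) (foldr (\<lambda>i. AllIn i j) js \<phi>)" if "y \<in> set_decode (\<rho> j)" for y
      using that Cons.prems by auto
    show ?R
    proof (intro allI impI)
      fix \<rho>' assume \<rho>': "(\<forall>k. k \<notin> set (i # js) \<longrightarrow> \<rho>' k = \<rho> k) \<and>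
        (\<forall>k \<in> set (i # js). \<rho>' k \<in> set_decode (\<rho> j))"
      then have "\<rho>' i \<in> set_decode (\<rho> j)" by simp
      moreover have "j \<notin> set js" "i \<noteq> j" using Cons.prems by auto
      ultimately show "sat \<rho>' \<phi>"
        using L[of "\<rho>' i", unfolded Cons.IH[OF \<open>j \<notin> set js\<close>], rule_format, of \<rho>'] \<rho>' by auto
    qed
  next
    assume R: ?R
    have "sat (\<rho>(i := y)) (foldr (\<lambda>i. AllIn i j) js \<phi>)" if "y \<in> set_decode (\<rho> j)" for y
    proof (subst Cons.IH)
      show "\<forall>\<rho>'. (\<forall>k. k \<notin> set js \<longrightarrow> \<rho>' k = (\<rho>(i := y)) k) \<and>
          (\<forall>k \<in> set js. \<rho>' k \<in> set_decode ((\<rho>(i := y)) j)) \<longrightarrow> sat \<rho>' \<phi>"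
      proof (intro allI impI)
        fix \<rho>' assume \<rho>': "(\<forall>k. k \<notin> set js \<longrightarrow> \<rho>' k = (\<rho>(i := y)) k) \<and>
          (\<forall>k \<in> set js. \<rho>' k \<in> set_decode ((\<rho>(i := y)) j))"
        moreover have "i \<noteq> j" using Cons.prems by auto
        ultimately show "sat \<rho>' \<phi>"
          using that by (intro R[rule_format]) (cases "i \<in> set js"; auto)
      qed
    qed (use Cons.prems in simp)
    then show ?L using Cons.prems by auto
  qed
qed

section \<open>Numbering the automaton\<close>

text \<open>Numbering states by \<open>term_code\<close> lets a formula read the symbol and the
  arguments of a state off its number.\<close>

definition bta_rules :: "gterm set \<Rightarrow> (gterm \<times> gterm) set \<Rightarrow> bta_rule set" where
  "bta_rules S E = {Trans f (map term_code ts) (term_code (Fun f ts)) | f ts. Fun f ts \<in> S} \<union>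
     {Eps (term_code a) (term_code b) | a b. (a, b) \<in> E}"

definition term_bta :: "symb set \<Rightarrow> gterm set \<Rightarrow> gterm set \<Rightarrow> (gterm \<times> gterm) set \<Rightarrow> bta" where
  "term_bta \<Sigma> L S E = \<lparr>alphabet = \<Sigma>, states = term_code ` S, rules = bta_rules S E,
     finals = term_code ` L\<rparr>"

lemma inj_term_code: "inj term_code"
proof (rule injI)
  show "s = t" if "term_code s = term_code t" for s t
    using that
  proof (induction s arbitrary: t)
    case (Var x)
    then show ?case by (cases t) (auto simp: sum_encode_eq)
  next
    case (Fun f ss)
    then obtain ts where t: "t = Fun f ts" "map term_code ss = map term_code ts"
      by (cases t) (auto simp: sum_encode_eq list_encode_eq)
    then have "length ss = length ts" by (metis length_map)
    moreover have "ss ! i = ts ! i" if "i < length ss" for i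
      using Fun.IH[of "ss ! i" "ts ! i"] t(2) that calculation by (metis nth_map nth_mem)
    ultimately show ?case using t(1) by (simp add: list_eq_iff_nth_eq)
  qed
qed

lemma term_code_eq [simp]: "term_code s = term_code t \<longleftrightarrow> s = t"
  using inj_term_code by (auto dest: injD)

lemma map_term_code_eq [simp]: "map term_code ss = map term_code ts \<longleftrightarrow> ss = ts"
  using inj_map_eq_map[OF inj_term_code] by blast

lemma rule_code_eq [simp]: "rule_code \<rho> = rule_code \<rho>' \<longleftrightarrow> \<rho> = \<rho>'"
  by (cases \<rho>; cases \<rho>') (auto simp: sum_encode_eq list_encode_eq)

lemma finite_bta_rules: "finite S \<Longrightarrow> finite E \<Longrightarrow> finite (bta_rules S E)"
proof -
  assume "finite S" "finite E"
  moreover have "bta_rules S E \<subseteq>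
      (\<lambda>t. case t of Fun f ts \<Rightarrow> Trans f (map term_code ts) (term_code t)) ` S \<union>
      (\<lambda>(a, b). Eps (term_code a) (term_code b)) ` E"
    by (force simp: bta_rules_def)
  ultimately show ?thesis by (meson finite_UnI finite_imageI finite_subset)
qed

text \<open>Derivations of the automaton pass through terms that mix symbols and states, so
  acceptance has to be extended to these.\<close>

inductive mixed_accepts ::
  "(gterm \<times> gterm) set \<Rightarrow> (symb + nat, nat) trm \<Rightarrow> gterm \<Rightarrow> bool" for E where
  state: "(a, b) \<in> E \<Longrightarrow> mixed_accepts E (state (term_code a)) b"
| step: "list_all2 (mixed_accepts E) us ss \<Longrightarrow> (Fun f ss, s) \<in> E \<Longrightarrow>
    mixed_accepts E (Fun (Inl f) us) s"

lemma mixed_accepts_Fun_iff: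
  "mixed_accepts E (Fun (Inl f) us) s \<longleftrightarrow> (\<exists>ss. list_all2 (mixed_accepts E) us ss \<and> (Fun f ss, s) \<in> E)"
  by (subst mixed_accepts.simps) (auto simp: state_def)

lemma mixed_accepts_state_iff [simp]:
  "mixed_accepts E (state (term_code a)) b \<longleftrightarrow> (a, b) \<in> E"
  by (subst mixed_accepts.simps) (auto simp: state_def)

lemma mixed_accepts_Var [simp]: "\<not> mixed_accepts E (Var x) s"
  by (subst mixed_accepts.simps) (auto simp: state_def)

lemma mixed_accepts_map: "mixed_accepts E (map_trm Inl id u) s \<longleftrightarrow> accepts E u s"
proof (induction u arbitrary: s)
  case (Fun f us)
  have "mixed_accepts E (map_trm Inl id (us ! i)) s \<longleftrightarrow> accepts E (us ! i) s" if "i < length us" for i s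
    using Fun.IH[OF nth_mem[OF that]] .
  then have "list_all2 (mixed_accepts E) (map (map_trm Inl id) us) ss \<longleftrightarrow> list_all2 (accepts E) us ss"
    for ss unfolding list_all2_conv_all_nth by (metis length_map nth_map)
  then show ?case unfolding trm.map mixed_accepts_Fun_iff accepts_Fun_iff by simp
qed simp

lemma subst_state [simp]: "subst \<sigma> (state a) = state a"
  by (simp add: state_def)

text \<open>Undoing a transition costs a reflexive pair at each argument, and undoing a rule
  \<open>a \<rightarrow> b\<close> is absorbed by transitivity.\<close>

lemma mixed_accepts_expansion:
  assumes E: "E \<subseteq> S \<times> S" "refl_on S E" "trans E" "arg_closed S"
    and "rstep (rewrite_rule ` bta_rules S E) m m'" "mixed_accepts E m' s"
  shows "mixed_accepts E m s"
  using assms(5,6)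
proof (induction arbitrary: s)
  case (root l r \<sigma>)
  then obtain \<rho> where \<rho>: "\<rho> \<in> bta_rules S E" "(l, r) = rewrite_rule \<rho>" by auto
  from \<rho>(1) consider f ts where "Fun f ts \<in> S" "\<rho> = Trans f (map term_code ts) (term_code (Fun f ts))"
    | a b where "(a, b) \<in> E" "\<rho> = Eps (term_code a) (term_code b)"
    by (auto simp: bta_rules_def)
  then show ?case
  proof cases
    case 1
    then have "r = state (term_code (Fun f ts))"
      and l: "subst \<sigma> l = Fun (Inl f) (map (\<lambda>t. state (term_code t)) ts)"
      using \<rho>(2) by (auto simp del: term_code.simps)
    with root.prems have "(Fun f ts, s) \<in> E" by (auto simp del: term_code.simps)
    moreover have "(t, t) \<in> E" if "t \<in> set ts" for t
      using arg_closedD[OF E(4) 1(1) that] E(2) by (auto dest: refl_onD)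
    ultimately show ?thesis
      by (auto simp: l mixed_accepts_Fun_iff list_all2_conv_all_nth intro!: exI[of _ ts])
  next
    case 2
    with \<rho>(2) root.prems have "subst \<sigma> l = state (term_code a)" "(b, s) \<in> E" by auto
    with 2 E(3) show ?thesis by (auto dest: transD)
  qed
next
  case (arg u v f us vs)
  show ?case
  proof (cases f)
    case (Inl g)
    with arg.prems obtain ss where
      ss: "list_all2 (mixed_accepts E) (us @ v # vs) ss" "(Fun g ss, s) \<in> E"
      by (auto simp: mixed_accepts_Fun_iff)
    then obtain ss1 a ss2 where "ss = ss1 @ a # ss2" "list_all2 (mixed_accepts E) us ss1"
      "mixed_accepts E v a" "list_all2 (mixed_accepts E) vs ss2"
      by (auto simp: list_all2_append1 list_all2_Cons1)
    with arg.IH ss(2) Inl show ?thesis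
      by (auto simp: mixed_accepts_Fun_iff intro!: exI[of _ ss] list_all2_appendI)
  next
    \<comment> \<open>A state has no arguments, so no step can take place inside it.\<close>
    case (Inr n)
    with arg.prems show ?thesis by (cases rule: mixed_accepts.cases) (auto simp: state_def)
  qed
qed

lemma mixed_accepts_rsteps:
  assumes "E \<subseteq> S \<times> S" "mixed_accepts E m s"
  shows "(rstep (rewrite_rule ` bta_rules S E))\<^sup>*\<^sup>* m (state (term_code s))"
proof -
  let ?R = "rewrite_rule ` bta_rules S E"
  have eps: "rstep ?R (state (term_code a)) (state (term_code b))" if "(a, b) \<in> E" for a b
  proof -
    have "Eps (term_code a) (term_code b) \<in> bta_rules S E" using that by (auto simp: bta_rules_def)
    then have "(state (term_code a), state (term_code b)) \<in> ?R" by force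
    from rstep.root[OF this, of Var] show ?thesis by simp
  qed
  show ?thesis
    using assms(2)
  proof (induction)
    case (state a b)
    then show ?case using eps by blast
  next
    case (step us ss f s)
    let ?states = "map (\<lambda>t. state (term_code t)) ss"
    have "list_all2 (rstep ?R)\<^sup>*\<^sup>* us ?states"
      using step.IH by (auto simp: list_all2_conv_all_nth)
    from rstep_args[OF this, of "Inl f" "[]"]
    have "(rstep ?R)\<^sup>*\<^sup>* (Fun (Inl f) us) (Fun (Inl f) ?states)" by simp
    also have "rstep ?R (Fun (Inl f) ?states) (state (term_code (Fun f ss)))"
    proof -
      have "Trans f (map term_code ss) (term_code (Fun f ss)) \<in> bta_rules S E"
        using step.hyps assms(1) unfolding bta_rules_def by blast
      then have "rewrite_rule (Trans f (map term_code ss) (term_code (Fun f ss))) \<in> ?R"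
        by (rule imageI)
      then have "(Fun (Inl f) ?states, state (term_code (Fun f ss))) \<in> ?R"
        by (simp add: comp_def del: term_code.simps)
      from rstep.root[OF this, of Var] show ?thesis by (simp add: comp_def del: term_code.simps)
    qed
    also have "rstep ?R (state (term_code (Fun f ss))) (state (term_code s))"
      using step.hyps by (intro eps)
    finally show ?case .
  qed
qed

lemma bta_lang_term_bta:
  assumes sat: "saturated \<Sigma> L R S E"
  shows "bta_lang (term_bta \<Sigma> L S E) = {u. \<exists>s \<in> L. accepts E u s}"
proof -
  have E: "E \<subseteq> S \<times> S" "refl_on S E" "trans E" "arg_closed S" and L: "L \<subseteq> S"
    using sat by (auto simp: saturated_def)
  have "(rstep (rewrite_rule ` bta_rules S E))\<^sup>*\<^sup>* (map_trm Inl id u) (state (term_code s)) \<longleftrightarrow>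
      accepts E u s" if "s \<in> L" for u s
  proof
    assume "accepts E u s"
    then show "(rstep (rewrite_rule ` bta_rules S E))\<^sup>*\<^sup>* (map_trm Inl id u) (state (term_code s))"
      using mixed_accepts_rsteps[OF E(1)] by (simp add: mixed_accepts_map)
  next
    assume "(rstep (rewrite_rule ` bta_rules S E))\<^sup>*\<^sup>* (map_trm Inl id u) (state (term_code s))"
    then have "mixed_accepts E (map_trm Inl id u) s"
    proof (induction rule: converse_rtranclp_induct)
      case base
      then show ?case using that L E(2) by (auto dest: refl_onD)
    next
      case (step m m')
      then show ?case using mixed_accepts_expansion[OF E] by blast
    qed
    then show "accepts E u s" by (simp add: mixed_accepts_map)
  qed
  then show ?thesis
    using accepts_ground[OF sat] by (auto simp: bta_lang_def term_bta_def)
qed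

lemma bta_over_term_bta:
  assumes sat: "saturated \<Sigma> L R S E"
  shows "bta_over \<Sigma> (term_bta \<Sigma> L S E)"
proof -
  have E: "E \<subseteq> S \<times> S" "finite S" "arg_closed S" "L \<subseteq> S" "S \<subseteq> ground_terms \<Sigma>"
    using sat by (auto simp: saturated_def)
  then have "finite E" by (blast intro: finite_subset)
  moreover have "wf_rule \<Sigma> (term_code ` S) \<rho>" if "\<rho> \<in> bta_rules S E" for \<rho>
  proof -
    from that consider
        f ts where "Fun f ts \<in> S" "\<rho> = Trans f (map term_code ts) (term_code (Fun f ts))"
      | a b where "(a, b) \<in> E" "\<rho> = Eps (term_code a) (term_code b)"
      by (auto simp: bta_rules_def)
    then show ?thesis
    proof cases
      case 1
      then have "Fun f ts \<in> terms \<Sigma>" using E(5) by (auto simp: ground_terms_def)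
      moreover have "set ts \<subseteq> S" using arg_closedD[OF E(3) 1(1)] by blast
      ultimately show ?thesis using 1 by (auto simp: terms_Fun_iff simp del: term_code.simps)
    next
      case 2
      with E(1) show ?thesis by auto
    qed
  qed
  ultimately show ?thesis
    using E finite_bta_rules by (auto simp: bta_over_def term_bta_def)
qed

lemma bta_code_term_bta:
  "bta_code (term_bta \<Sigma> L S E) = prod_encode (alphabet_code \<Sigma>, prod_encode (set_encode (term_code ` S),
     prod_encode (set_encode (rule_code ` bta_rules S E), lang_code L)))"
  by (simp add: bta_code_def term_bta_def lang_code_def)

section \<open>The search\<close>

text \<open>Names of variables: \<open>0\<close> holds the result of a search and \<open>3\<close> a bound; \<open>1\<close> and \<open>2\<close> hold
  the codes of the alphabet and of the language, \<open>4\<close> and \<open>5\<close> those of the states and of the rules, and \<open>6\<close> a set that witnesses the ranks (see \<open>ranks_ok\<close>);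
  \<open>7\<close> to \<open>10\<close> are auxiliary. In the formula for a rewrite rule \<open>l \<rightarrow> r\<close>, the state at the position \<open>p\<close>
  of \<open>l\<close> has the name \<open>node p\<close> and the value of the variable \<open>x\<close> has the name \<open>binding x\<close>.\<close>

definition node :: "nat list \<Rightarrow> nat" where
  "node p = 12 + 2 * list_encode p"

definition binding :: "nat \<Rightarrow> nat" where
  "binding x = 13 + 2 * x"

definition fun_expr :: "expr \<Rightarrow> expr \<Rightarrow> expr" where
  "fun_expr f a = Sc (Db (Pr f a))"

definition trans_expr :: "expr \<Rightarrow> expr \<Rightarrow> expr \<Rightarrow> expr" where
  "trans_expr f as a = Db (Pr f (Pr as a))"

definition eps_expr :: "expr \<Rightarrow> expr \<Rightarrow> expr" where
  "eps_expr a b = Sc (Db (Pr a b))"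

primrec list_expr :: "expr list \<Rightarrow> expr" where
  "list_expr [] = Cst 0"
| "list_expr (a # as) = Sc (Pr a (list_expr as))"

primrec rhs_expr :: "gterm \<Rightarrow> expr" where
  "rhs_expr (Var x) = V (binding x)"
| "rhs_expr (Fun f ts) = fun_expr (Cst (prod_encode f)) (list_expr (map rhs_expr ts))"

text \<open>Defined on arbitrary numbers, because a formula handles a number before it is known to
  code a symbol or a term.\<close>

definition fun_code :: "nat \<Rightarrow> nat \<Rightarrow> nat" where
  "fun_code f as = sum_encode (Inr (prod_encode (f, as)))"

definition trans_code :: "nat \<Rightarrow> nat \<Rightarrow> nat \<Rightarrow> nat" where
  "trans_code f as a = sum_encode (Inl (prod_encode (f, prod_encode (as, a))))"

definition eps_code :: "nat \<Rightarrow> nat \<Rightarrow> nat" where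
  "eps_code a b = sum_encode (Inr (prod_encode (a, b)))"

lemma evl_codes [simp]:
  "evl \<rho> (fun_expr f as) = fun_code (evl \<rho> f) (evl \<rho> as)"
  "evl \<rho> (trans_expr f as a) = trans_code (evl \<rho> f) (evl \<rho> as) (evl \<rho> a)"
  "evl \<rho> (eps_expr a b) = eps_code (evl \<rho> a) (evl \<rho> b)"
  by (simp_all add: fun_expr_def trans_expr_def eps_expr_def fun_code_def trans_code_def eps_code_def
      sum_encode_def)

lemma codes_inject [simp]:
  "fun_code f as = fun_code g bs \<longleftrightarrow> f = g \<and> as = bs"
  "trans_code f as a = trans_code g bs b \<longleftrightarrow> f = g \<and> as = bs \<and> a = b"
  "eps_code a b = eps_code c d \<longleftrightarrow> a = c \<and> b = d"
  "trans_code f as a \<noteq> eps_code c d"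
  "eps_code c d \<noteq> trans_code f as a"
  by (simp_all add: fun_code_def trans_code_def eps_code_def sum_encode_eq)

lemma term_code_Fun: "term_code (Fun f ts) = fun_code (prod_encode f) (list_encode (map term_code ts))"
  by (simp add: fun_code_def)

lemma rule_code_codes:
  "rule_code (Trans f as a) = trans_code (prod_encode f) (list_encode as) a"
  "rule_code (Eps a b) = eps_code a b"
  by (simp_all add: trans_code_def eps_code_def)

lemma fun_code_less: "f < fun_code f as" "as < fun_code f as"
  using le_prod_encode_1[of f as] le_prod_encode_2[of as f]
  by (auto simp: fun_code_def sum_encode_def)

text \<open>The inequalities are weak since \<open>sum_encode (Inl 0) = 0\<close>; this is why
  \<open>rules_form\<close> has the bound \<open>Sc (V 7)\<close>.\<close>

lemma trans_code_le: "f \<le> trans_code f as a" "as \<le> trans_code f as a"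
  using le_prod_encode_1[of f "prod_encode (as, a)"] le_prod_encode_2[of "prod_encode (as, a)" f]
    le_prod_encode_1[of as a]
  by (auto simp: trans_code_def sum_encode_def)

lemma list_encode_less: "x \<in> set xs \<Longrightarrow> x < list_encode xs"
proof (induction xs)
  case (Cons y xs)
  then show ?case
    using le_prod_encode_1[of y "list_encode xs"] le_prod_encode_2[of "list_encode xs" y] by auto
qed simp

lemma evl_list_expr: "evl \<rho> (list_expr as) = list_encode (map (evl \<rho>) as)"
  by (induction as) auto

lemma evl_rhs_expr:
  "(\<And>x. x \<in> vars r \<Longrightarrow> \<rho> (binding x) = term_code (\<sigma> x)) \<Longrightarrow> evl \<rho> (rhs_expr r) = term_code (subst \<sigma> r)"
proof (induction r)
  case (Fun f ts)
  then have "map (evl \<rho>) (map rhs_expr ts) = map term_code (map (subst \<sigma>) ts)" by auto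
  then show ?case by (simp add: evl_list_expr term_code_Fun del: term_code.simps map_map)
qed simp

definition node_form :: "gterm \<Rightarrow> nat list \<Rightarrow> form" where
  "node_form l p = (case subt l p of
     Var x \<Rightarrow> Eq (V (node p)) (V (binding x))
   | Fun f ts \<Rightarrow> Mem (eps_expr (fun_expr (Cst (prod_encode f))
       (list_expr (map (\<lambda>i. V (node (p @ [i]))) [0..<length ts]))) (V (node p))) (V 5))"

definition rule_names :: "gterm \<Rightarrow> nat list" where
  "rule_names l = sorted_list_of_set (node ` POS l \<union> binding ` vars l)"

text \<open>As \<open>R\<close> is fixed, \<open>l\<close> and \<open>r\<close> are unrolled into
  the formula and \<open>run\<close> becomes a finite conjunction. Positions are enumerated through
  their codes to have a linear order.\<close>

definition rule_form :: "gterm \<times> gterm \<Rightarrow> form" where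
  "rule_form = (\<lambda>(l, r). foldr (\<lambda>i. AllIn i 4) (rule_names l)
     (Imp (Conj (map (\<lambda>i. node_form l (list_decode i)) (sorted_list_of_set (list_encode ` POS l))))
        (Mem (eps_expr (rhs_expr r) (V (node []))) (V 5))))"

definition eps_rel :: "nat \<Rightarrow> (gterm \<times> gterm) set" where
  "eps_rel U = {(a, b). eps_code (term_code a) (term_code b) \<in> set_decode U}"

lemma set_rule_names: "set (rule_names l) = node ` POS l \<union> binding ` vars l"
  unfolding rule_names_def by (intro set_sorted_list_of_set) (simp add: finite_POS finite_vars)

lemma names_inject [simp]:
  "node p = node q \<longleftrightarrow> p = q" "binding x = binding y \<longleftrightarrow> x = y" "node p \<noteq> binding x" "binding x \<noteq> node p"
  by (simp_all add: node_def binding_def list_encode_eq) presburger+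

lemma names_fresh: "k < 12 \<Longrightarrow> k \<notin> set (rule_names l)"
  by (auto simp: set_rule_names node_def binding_def)

lemma sat_node_forms:
  assumes "\<And>p. p \<in> POS l \<Longrightarrow> \<rho> (node p) = term_code (\<eta> p)"
    and "\<And>x. x \<in> vars l \<Longrightarrow> \<rho> (binding x) = term_code (\<sigma> x)"
  shows "(\<forall>p \<in> POS l. sat \<rho> (node_form l p)) \<longleftrightarrow> run (eps_rel (\<rho> 5)) \<sigma> l \<eta>"
proof -
  have "sat \<rho> (node_form l p) \<longleftrightarrow> (case subt l p of
       Var x \<Rightarrow> \<eta> p = \<sigma> x
     | Fun f ts \<Rightarrow> (Fun f (map (\<lambda>i. \<eta> (p @ [i])) [0..<length ts]), \<eta> p) \<in> eps_rel (\<rho> 5))"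
    if p: "p \<in> POS l" for p
  proof (cases "subt l p")
    case (Var x)
    with p have "x \<in> vars l" by (auto simp: vars_iff_POS)
    with Var p assms show ?thesis by (simp add: node_form_def)
  next
    case (Fun f ts)
    have "\<rho> (node (p @ [i])) = term_code (\<eta> (p @ [i]))" if "i < length ts" for i
      using Fun p assms(1) that by (auto simp: POS_snoc)
    then have "list_encode (map (\<lambda>i. \<rho> (node (p @ [i]))) [0..<length ts]) =
        list_encode (map (\<lambda>i. term_code (\<eta> (p @ [i]))) [0..<length ts])"
      by (intro arg_cong[where f = list_encode] map_cong) auto
    then show ?thesis
      using Fun p assms(1)
      by (simp add: node_form_def eps_rel_def evl_list_expr term_code_Fun comp_def del: term_code.simps)
  qed
  then show ?thesis by (simp add: run_def)
qed

text \<open>Letting all names range over \<open>S\<close> loses no run: on a non-variable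
  \<open>l\<close> each node has a state in \<open>S\<close>, and a variable has the state of its
  position.\<close>

lemma sat_rule_form:
  assumes S: "set_decode (\<rho> 4) = term_code ` S" "arg_closed S" "eps_rel (\<rho> 5) \<subseteq> S \<times> S"
    and lr: "\<not> is_Var l" "vars r \<subseteq> vars l"
  shows "sat \<rho> (rule_form (l, r)) \<longleftrightarrow>
    (\<forall>\<sigma> \<eta>. run (eps_rel (\<rho> 5)) \<sigma> l \<eta> \<longrightarrow> (subst \<sigma> r, \<eta> []) \<in> eps_rel (\<rho> 5))"
    (is "_ \<longleftrightarrow> ?R")
proof -
  let ?E = "eps_rel (\<rho> 5)"
  let ?\<phi> = "Imp (Conj (map (\<lambda>i. node_form l (list_decode i)) (sorted_list_of_set (list_encode ` POS l))))
        (Mem (eps_expr (rhs_expr r) (V (node []))) (V 5))"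
  have body: "sat \<rho>' ?\<phi> \<longleftrightarrow> (run ?E \<sigma> l \<eta> \<longrightarrow> (subst \<sigma> r, \<eta> []) \<in> ?E)"
    if "\<rho>' 5 = \<rho> 5" "\<And>p. p \<in> POS l \<Longrightarrow> \<rho>' (node p) = term_code (\<eta> p)"
      "\<And>x. x \<in> vars l \<Longrightarrow> \<rho>' (binding x) = term_code (\<sigma> x)" for \<rho>' \<sigma> \<eta>
  proof -
    have "evl \<rho>' (rhs_expr r) = term_code (subst \<sigma> r)"
      using that(3) lr(2) by (intro evl_rhs_expr) auto
    with sat_node_forms[of l \<rho>' \<eta> \<sigma>] that show ?thesis
      by (simp add: finite_POS image_image) (simp add: eps_rel_def)
  qed
  have "sat \<rho> (rule_form (l, r)) \<longleftrightarrow> (\<forall>\<rho>'. (\<forall>i. i \<notin> set (rule_names l) \<longrightarrow> \<rho>' i = \<rho> i) \<and>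
      (\<forall>i \<in> set (rule_names l). \<rho>' i \<in> set_decode (\<rho> 4)) \<longrightarrow> sat \<rho>' ?\<phi>)"
    unfolding rule_form_def prod.case by (rule sat_AllIns) (simp add: names_fresh)
  also have "\<dots> \<longleftrightarrow> ?R"
  proof (intro iffI allI impI)
    fix \<sigma> \<eta>
    assume L: "\<forall>\<rho>'. (\<forall>i. i \<notin> set (rule_names l) \<longrightarrow> \<rho>' i = \<rho> i) \<and>
        (\<forall>i \<in> set (rule_names l). \<rho>' i \<in> set_decode (\<rho> 4)) \<longrightarrow> sat \<rho>' ?\<phi>"
      and run: "run ?E \<sigma> l \<eta>"
    define \<rho>' where "\<rho>' i = (if i \<in> node ` POS l then term_code (\<eta> (inv node i))
      else if i \<in> binding ` vars l then term_code (\<sigma> (inv binding i)) else \<rho> i)" for i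
    have inj: "inj node" "inj binding" by (auto intro: injI)
    have \<eta>: "\<rho>' (node p) = term_code (\<eta> p)" if "p \<in> POS l" for p
      using that by (auto simp: \<rho>'_def inv_f_f[OF inj(1)])
    have \<sigma>: "\<rho>' (binding x) = term_code (\<sigma> x)" if "x \<in> vars l" for x
      using that by (auto simp: \<rho>'_def inv_f_f[OF inj(2)])
    have \<eta>S: "\<eta> p \<in> S" if "p \<in> POS l" for p
      using run_states[OF run lr(1) S(3,2) that] .
    have \<sigma>S: "\<sigma> x \<in> S" if "x \<in> vars l" for x
    proof -
      from that obtain p where "p \<in> POS l" "subt l p = Var x" by (auto simp: vars_iff_POS)
      moreover from this run have "\<eta> p = \<sigma> x" by (force simp: run_def)
      ultimately show ?thesis using \<eta>S by metis
    qed
    have "sat \<rho>' ?\<phi>"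
    proof (rule L[rule_format], intro conjI allI ballI impI)
      show "\<rho>' i = \<rho> i" if "i \<notin> set (rule_names l)" for i
        using that by (simp add: \<rho>'_def set_rule_names)
      show "\<rho>' i \<in> set_decode (\<rho> 4)" if "i \<in> set (rule_names l)" for i
        using that \<eta> \<sigma> \<eta>S \<sigma>S by (auto simp: set_rule_names S(1) simp del: term_code.simps)
    qed
    moreover have "\<rho>' 5 = \<rho> 5" by (auto simp: \<rho>'_def node_def binding_def)
    ultimately show "(subst \<sigma> r, \<eta> []) \<in> ?E" using body \<eta> \<sigma> run by blast
  next
    fix \<rho>'
    assume R: ?R and \<rho>': "(\<forall>i. i \<notin> set (rule_names l) \<longrightarrow> \<rho>' i = \<rho> i) \<and>
        (\<forall>i \<in> set (rule_names l). \<rho>' i \<in> set_decode (\<rho> 4))"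
    have "\<rho>' i = term_code (inv term_code (\<rho>' i))" if "i \<in> set (rule_names l)" for i
      using \<rho>' that S(1) by (metis f_inv_into_f imageE rangeI)
    then show "sat \<rho>' ?\<phi>"
      using body[of \<rho>' "\<lambda>p. inv term_code (\<rho>' (node p))" "\<lambda>x. inv term_code (\<rho>' (binding x))"]
        R \<rho>' names_fresh[of 5 l] by (auto simp: set_rule_names)
  qed
  finally show ?thesis .
qed

text \<open>Formulas cannot recurse over a coded list, so its length is certified by a set \<open>W\<close> of
  pairs of a list of states and its length that is closed under tails.\<close>

definition ranks_ok :: "gterm set \<Rightarrow> nat \<Rightarrow> bool" where
  "ranks_ok S W \<longleftrightarrow>
     (\<forall>f ts. Fun f ts \<in> S \<longrightarrow> prod_encode (list_encode (map term_code ts), rank f) \<in> set_decode W) \<and>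
     (\<forall>w \<in> set_decode W. w = prod_encode (0, 0) \<or> (\<exists>x \<in> term_code ` S. \<exists>as n.
        w = prod_encode (Suc (prod_encode (x, as)), Suc n) \<and> prod_encode (as, n) \<in> set_decode W))"

text \<open>The symbol is split into its name \<open>V 8\<close> and its rank \<open>V 9\<close>,
  because the rank has to be the length of the argument list \<open>V 10\<close>, as certified by
  \<open>V 6\<close>.\<close>

definition states_form :: form where
  "states_form = AllIn 7 4 (Exists 8 (V 7) (Exists 9 (V 7) (Exists 10 (V 7) (Conj
     [Eq (V 7) (fun_expr (Pr (V 8) (V 9)) (V 10)),
      Mem (Pr (V 8) (V 9)) (V 1),
      Mem (Pr (V 10) (V 9)) (V 6),
      Mem (trans_expr (Pr (V 8) (V 9)) (V 10) (V 7)) (V 5),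
      Mem (eps_expr (V 7) (V 7)) (V 5)]))))"

definition ranks_form :: form where
  "ranks_form = AllIn 7 6 (Or (Eq (V 7) (Pr (Cst 0) (Cst 0)))
     (ExIn 8 4 (Exists 9 (V 7) (Exists 10 (V 7)
       (And (Eq (V 7) (Pr (Sc (Pr (V 8) (V 9))) (Sc (V 10)))) (Mem (Pr (V 9) (V 10)) (V 6)))))))"

text \<open>Excludes any further rules, so that \<open>V 5\<close> is exactly the code of
  \<open>bta_rules S E\<close> for some \<open>S\<close> and \<open>E\<close>.\<close>

definition rules_form :: form where
  "rules_form = AllIn 7 5 (Or
     (Exists 8 (Sc (V 7)) (Exists 9 (Sc (V 7)) (And (Mem (fun_expr (V 8) (V 9)) (V 4))
       (Eq (V 7) (trans_expr (V 8) (V 9) (fun_expr (V 8) (V 9)))))))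
     (ExIn 8 4 (ExIn 9 4 (Eq (V 7) (eps_expr (V 8) (V 9))))))"

definition trans_form :: form where
  "trans_form = AllIn 7 4 (AllIn 8 4 (AllIn 9 4 (Imp (Mem (eps_expr (V 7) (V 8)) (V 5))
     (Imp (Mem (eps_expr (V 8) (V 9)) (V 5)) (Mem (eps_expr (V 7) (V 9)) (V 5))))))"

definition saturated_form :: "(gterm \<times> gterm) list \<Rightarrow> form" where
  "saturated_form rs = Conj ([states_form, ranks_form, rules_form, AllIn 7 2 (Mem (V 7) (V 4)), trans_form]
     @ map rule_form rs)"

lemma sat_states_form:
  "sat \<rho> states_form \<longleftrightarrow> (\<forall>a \<in> set_decode (\<rho> 4). \<exists>f as. a = fun_code (prod_encode f) as \<and>
     prod_encode f \<in> set_decode (\<rho> 1) \<and> prod_encode (as, rank f) \<in> set_decode (\<rho> 6) \<and>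
     trans_code (prod_encode f) as a \<in> set_decode (\<rho> 5) \<and> eps_code a a \<in> set_decode (\<rho> 5))"
    (is "_ \<longleftrightarrow> ?R")
proof -
  have bound: "x < a \<and> y < a \<and> as < a" if "a = fun_code (prod_encode (x, y)) as" for a x y as
    using that fun_code_less le_prod_encode_1[of x y] le_prod_encode_2[of y x] by (auto intro: le_less_trans)
  have "sat \<rho> states_form \<longleftrightarrow> (\<forall>a \<in> set_decode (\<rho> 4). \<exists>x<a. \<exists>y<a. \<exists>as<a.
     a = fun_code (prod_encode (x, y)) as \<and>
     prod_encode (x, y) \<in> set_decode (\<rho> 1) \<and> prod_encode (as, y) \<in> set_decode (\<rho> 6) \<and>
     trans_code (prod_encode (x, y)) as a \<in> set_decode (\<rho> 5) \<and> eps_code a a \<in> set_decode (\<rho> 5))"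
    by (simp add: states_form_def)
  also have "\<dots> \<longleftrightarrow> ?R"
  proof (intro ball_cong refl iffI)
    fix a assume "\<exists>f as. a = fun_code (prod_encode f) as \<and>
      prod_encode f \<in> set_decode (\<rho> 1) \<and> prod_encode (as, rank f) \<in> set_decode (\<rho> 6) \<and>
      trans_code (prod_encode f) as a \<in> set_decode (\<rho> 5) \<and> eps_code a a \<in> set_decode (\<rho> 5)"
    then obtain x y as where *: "a = fun_code (prod_encode (x, y)) as"
      "prod_encode (x, y) \<in> set_decode (\<rho> 1)" "prod_encode (as, y) \<in> set_decode (\<rho> 6)"
      "trans_code (prod_encode (x, y)) as a \<in> set_decode (\<rho> 5)" "eps_code a a \<in> set_decode (\<rho> 5)"
      by auto
    show "\<exists>x<a. \<exists>y<a. \<exists>as<a. a = fun_code (prod_encode (x, y)) as \<and>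
      prod_encode (x, y) \<in> set_decode (\<rho> 1) \<and> prod_encode (as, y) \<in> set_decode (\<rho> 6) \<and>
      trans_code (prod_encode (x, y)) as a \<in> set_decode (\<rho> 5) \<and> eps_code a a \<in> set_decode (\<rho> 5)"
      using * bound[OF *(1)] by (intro exI[of _ x] exI[of _ y] exI[of _ as] conjI) simp_all
  qed (metis snd_conv)
  finally show ?thesis .
qed

lemma sat_ranks_form:
  "sat \<rho> ranks_form \<longleftrightarrow> (\<forall>w \<in> set_decode (\<rho> 6). w = prod_encode (0, 0) \<or>
     (\<exists>x \<in> set_decode (\<rho> 4). \<exists>as n. w = prod_encode (Suc (prod_encode (x, as)), Suc n) \<and>
        prod_encode (as, n) \<in> set_decode (\<rho> 6)))"
proof -
  have bound: "as < w \<and> n < w" if "w = prod_encode (Suc (prod_encode (x, as)), Suc n)" for w x as n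
    using that le_prod_encode_1[of "Suc (prod_encode (x, as))" "Suc n"] le_prod_encode_2[of as x]
      le_prod_encode_2[of "Suc n" "Suc (prod_encode (x, as))"] by auto
  show ?thesis
    unfolding ranks_form_def by simp (use bound in blast)
qed

lemma sat_rules_form:
  "sat \<rho> rules_form \<longleftrightarrow> (\<forall>u \<in> set_decode (\<rho> 5).
     (\<exists>f as. fun_code f as \<in> set_decode (\<rho> 4) \<and> u = trans_code f as (fun_code f as)) \<or>
     (\<exists>a \<in> set_decode (\<rho> 4). \<exists>b \<in> set_decode (\<rho> 4). u = eps_code a b))"
proof -
  have bound: "f < Suc u \<and> as < Suc u" if "u = trans_code f as (fun_code f as)" for u f as
    using that trans_code_le by (simp add: less_Suc_eq_le)
  show ?thesis
    unfolding rules_form_def by simp (use bound in blast)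
qed

lemma sat_trans_form:
  "sat \<rho> trans_form \<longleftrightarrow> (\<forall>a \<in> set_decode (\<rho> 4). \<forall>b \<in> set_decode (\<rho> 4). \<forall>c \<in> set_decode (\<rho> 4).
     eps_code a b \<in> set_decode (\<rho> 5) \<longrightarrow> eps_code b c \<in> set_decode (\<rho> 5) \<longrightarrow>
     eps_code a c \<in> set_decode (\<rho> 5))"
  unfolding trans_form_def by simp

section \<open>Correctness of the saturation formula\<close>

lemma eps_rel_bta_rules:
  assumes "finite S" "finite E"
  shows "eps_rel (set_encode (rule_code ` bta_rules S E)) = E"
proof -
  have "finite (rule_code ` bta_rules S E)" using assms by (intro finite_imageI finite_bta_rules)
  moreover have "eps_code (term_code a) (term_code b) \<in> rule_code ` bta_rules S E \<longleftrightarrow> (a, b) \<in> E" for a b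
  proof
    assume "(a, b) \<in> E"
    then have "Eps (term_code a) (term_code b) \<in> bta_rules S E" by (auto simp: bta_rules_def)
    then show "eps_code (term_code a) (term_code b) \<in> rule_code ` bta_rules S E"
      unfolding rule_code_codes(2)[symmetric] by (rule imageI)
  qed (auto simp: bta_rules_def rule_code_codes simp del: rule_code.simps term_code.simps)
  ultimately show ?thesis by (auto simp: eps_rel_def)
qed

text \<open>Every number codes a list, so the point is its length: the tail of a certified list is
  certified with the length one less, down to the pair for the empty list.\<close>

lemma rank_witness:
  assumes "\<And>w. w \<in> set_decode W \<Longrightarrow> w = prod_encode (0, 0) \<or> (\<exists>x \<in> A. \<exists>as n.
      w = prod_encode (Suc (prod_encode (x, as)), Suc n) \<and> prod_encode (as, n) \<in> set_decode W)"
    and "prod_encode (as, n) \<in> set_decode W"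
  shows "\<exists>xs. as = list_encode xs \<and> length xs = n \<and> set xs \<subseteq> A"
  using assms(2)
proof (induction n arbitrary: as)
  case 0
  then show ?case using assms(1)[of "prod_encode (as, 0)"] by (intro exI[of _ "[]"]) auto
next
  case (Suc n)
  from assms(1)[OF Suc.prems] obtain x bs where
    x: "x \<in> A" "as = Suc (prod_encode (x, bs))" "prod_encode (bs, n) \<in> set_decode W"
    by auto
  with Suc.IH obtain xs where "bs = list_encode xs" "length xs = n" "set xs \<subseteq> A" by blast
  with x show ?case by (intro exI[of _ "x # xs"]) auto
qed

lemma term_code_cases:
  assumes "a = fun_code (prod_encode f) (list_encode xs)" "set xs \<subseteq> range term_code"
  shows "\<exists>ts. a = term_code (Fun f ts) \<and> xs = map term_code ts"
proof -
  from assms(2) have "xs = map term_code (map (inv term_code) xs)"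
    by (auto simp: f_inv_into_f subset_iff intro!: map_idI[symmetric])
  with assms(1) show ?thesis by (metis term_code_Fun)
qed

lemma sat_saturated_form:
  assumes L: "\<rho> 1 = alphabet_code \<Sigma>" "\<rho> 2 = lang_code L" "finite \<Sigma>" "finite L" "L \<subseteq> ground_terms \<Sigma>"
    and R: "trs \<Sigma>' (set rs)" "\<forall>(l, r) \<in> set rs. \<not> is_Var l"
  shows "sat \<rho> (saturated_form rs) \<longleftrightarrow> (\<exists>S E. \<rho> 4 = set_encode (term_code ` S) \<and>
    \<rho> 5 = set_encode (rule_code ` bta_rules S E) \<and> saturated \<Sigma> L (set rs) S E \<and> ranks_ok S (\<rho> 6))"
    (is "_ \<longleftrightarrow> ?P")
proof
  have alph: "set_decode (\<rho> 1) = prod_encode ` \<Sigma>" and lang: "set_decode (\<rho> 2) = term_code ` L"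
    using L by (simp_all add: alphabet_code_def lang_code_def)
  have vars: "vars r \<subseteq> vars l" and nv: "\<not> is_Var l" if "(l, r) \<in> set rs" for l r
    using R that by (auto simp: trs_def)
  {
    assume sat: "sat \<rho> (saturated_form rs)"
    \<comment> \<open>Only a preimage at first; that every number in the set codes a term is the
      claim \<open>ground\<close> below.\<close>
    define S where "S = term_code -` set_decode (\<rho> 4)"
    define E where "E = eps_rel (\<rho> 5)"
    have states: "\<exists>f as. a = fun_code (prod_encode f) as \<and> f \<in> \<Sigma> \<and>
        prod_encode (as, rank f) \<in> set_decode (\<rho> 6) \<and>
        trans_code (prod_encode f) as a \<in> set_decode (\<rho> 5) \<and> eps_code a a \<in> set_decode (\<rho> 5)"
      if "a \<in> set_decode (\<rho> 4)" for a
    proof -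
      have "sat \<rho> states_form" using sat by (simp add: saturated_form_def)
      with that obtain f as where "a = fun_code (prod_encode f) as" "prod_encode f \<in> set_decode (\<rho> 1)"
        "prod_encode (as, rank f) \<in> set_decode (\<rho> 6)"
        "trans_code (prod_encode f) as a \<in> set_decode (\<rho> 5)" "eps_code a a \<in> set_decode (\<rho> 5)"
        unfolding sat_states_form by blast
      moreover from this have "f \<in> \<Sigma>" unfolding alph by (simp add: inj_image_mem_iff[OF inj_prod_encode])
      ultimately show ?thesis by blast
    qed
    have ranks: "w = prod_encode (0, 0) \<or> (\<exists>x \<in> set_decode (\<rho> 4). \<exists>as n.
        w = prod_encode (Suc (prod_encode (x, as)), Suc n) \<and> prod_encode (as, n) \<in> set_decode (\<rho> 6))"
      if "w \<in> set_decode (\<rho> 6)" for w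
    proof -
      have "sat \<rho> ranks_form" using sat by (simp add: saturated_form_def)
      with that show ?thesis unfolding sat_ranks_form by blast
    qed
    \<comment> \<open>By the rank witness, the arguments of a state are states again. Their codes
      are smaller, so induction on the number applies.\<close>
    have ground: "\<exists>t \<in> ground_terms \<Sigma>. a = term_code t" if "a \<in> set_decode (\<rho> 4)" for a
      using that
    proof (induction a rule: less_induct)
      case (less a)
      from states[OF less.prems] obtain f as where
        f: "a = fun_code (prod_encode f) as" "f \<in> \<Sigma>" "prod_encode (as, rank f) \<in> set_decode (\<rho> 6)"
        by blast
      from rank_witness[OF ranks f(3)] obtain xs where
        xs: "as = list_encode xs" "length xs = rank f" "set xs \<subseteq> set_decode (\<rho> 4)"
        by blast
      have "x < a" if "x \<in> set xs" for x
        using list_encode_less[OF that] fun_code_less(2)[of as "prod_encode f"] xs f by simp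
      with less.IH xs(3) have args: "\<exists>t \<in> ground_terms \<Sigma>. x = term_code t" if "x \<in> set xs" for x
        using that by blast
      then have "set xs \<subseteq> range term_code" by blast
      from term_code_cases[OF f(1)[unfolded xs(1)] this] obtain ts where
        ts: "a = term_code (Fun f ts)" "xs = map term_code ts" by blast
      with args have "set ts \<subseteq> ground_terms \<Sigma>" by fastforce
      with ts xs(2) f(2) have "Fun f ts \<in> ground_terms \<Sigma>"
        by (auto simp: ground_terms_def terms_Fun_iff subset_iff)
      with ts(1) show ?case by blast
    qed
    have S: "set_decode (\<rho> 4) = term_code ` S" using ground by (auto simp: S_def)
    have S_ground: "S \<subseteq> ground_terms \<Sigma>"
    proof
      fix t assume "t \<in> S"
      with ground[of "term_code t"] show "t \<in> ground_terms \<Sigma>" by (auto simp: S_def)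
    qed
    have Fun_S: "prod_encode (list_encode (map term_code ts), rank f) \<in> set_decode (\<rho> 6) \<and>
        trans_code (prod_encode f) (list_encode (map term_code ts)) (term_code (Fun f ts)) \<in> set_decode (\<rho> 5)"
      if "Fun f ts \<in> S" for f ts
    proof -
      from that have "term_code (Fun f ts) \<in> set_decode (\<rho> 4)" by (simp add: S_def)
      from states[OF this] show ?thesis by (auto simp: term_code_Fun simp del: term_code.simps)
    qed
    have fin: "finite S"
      unfolding S_def by (intro finite_vimageI finite_set_decode inj_term_code)
    have closed: "arg_closed S"
      unfolding arg_closed_def
    proof (intro allI impI)
      fix f ts assume "Fun f ts \<in> S"
      with Fun_S have "prod_encode (list_encode (map term_code ts), rank f) \<in> set_decode (\<rho> 6)" by blast
      from rank_witness[OF ranks this] show "set ts \<subseteq> S" by (auto simp: list_encode_eq S_def)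
    qed
    have rules: "(\<exists>f as. fun_code f as \<in> set_decode (\<rho> 4) \<and> u = trans_code f as (fun_code f as)) \<or>
        (\<exists>a \<in> S. \<exists>b \<in> S. u = eps_code (term_code a) (term_code b))"
      if "u \<in> set_decode (\<rho> 5)" for u
    proof -
      have "sat \<rho> rules_form" using sat by (simp add: saturated_form_def)
      with that show ?thesis unfolding sat_rules_form S by blast
    qed
    have E: "E \<subseteq> S \<times> S"
    proof (rule subrelI)
      fix a b assume "(a, b) \<in> E"
      with rules[of "eps_code (term_code a) (term_code b)"] show "(a, b) \<in> S \<times> S"
        by (auto simp: E_def eps_rel_def)
    qed
    have decode_rules: "set_decode (\<rho> 5) = rule_code ` bta_rules S E"
    proof (intro equalityI subsetI)
      fix u assume u: "u \<in> set_decode (\<rho> 5)"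
      from rules[OF u] show "u \<in> rule_code ` bta_rules S E"
      proof (elim disjE exE conjE bexE)
        fix f as assume f: "fun_code f as \<in> set_decode (\<rho> 4)" "u = trans_code f as (fun_code f as)"
        then obtain t where t: "t \<in> S" "fun_code f as = term_code t" using S by auto
        with S_ground obtain g ts where "t = Fun g ts"
          by (cases t) (auto simp: ground_terms_def)
        with t f have "u = rule_code (Trans g (map term_code ts) (term_code (Fun g ts)))" "Fun g ts \<in> S"
          by (auto simp: term_code_Fun rule_code_codes simp del: term_code.simps rule_code.simps)
        then show ?thesis unfolding bta_rules_def by blast
      next
        fix a b assume "a \<in> S" "b \<in> S" "u = eps_code (term_code a) (term_code b)"
        with u have "u = rule_code (Eps (term_code a) (term_code b))" "(a, b) \<in> E"
          by (auto simp: rule_code_codes E_def eps_rel_def simp del: rule_code.simps)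
        then show ?thesis unfolding bta_rules_def by blast
      qed
    next
      fix u assume "u \<in> rule_code ` bta_rules S E"
      then show "u \<in> set_decode (\<rho> 5)"
        using Fun_S by (auto simp: bta_rules_def rule_code_codes E_def eps_rel_def
            simp del: term_code.simps rule_code.simps)
    qed
    have "L \<subseteq> S" using sat lang by (auto simp: saturated_form_def S_def)
    moreover have "refl_on S E"
    proof (rule refl_onI)
      fix t assume "t \<in> S"
      then have "term_code t \<in> set_decode (\<rho> 4)" by (simp add: S_def)
      from states[OF this] show "(t, t) \<in> E" by (auto simp: E_def eps_rel_def)
    qed
    moreover have "trans E"
    proof (rule transI)
      fix a b c assume abc: "(a, b) \<in> E" "(b, c) \<in> E"
      have "sat \<rho> trans_form" using sat by (simp add: saturated_form_def)
      with abc E show "(a, c) \<in> E" unfolding sat_trans_form S E_def eps_rel_def by blast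
    qed
    moreover have "\<forall>(l, r) \<in> set rs. \<forall>\<sigma> \<eta>. run E \<sigma> l \<eta> \<longrightarrow> (subst \<sigma> r, \<eta> []) \<in> E"
    proof (clarify)
      fix l r \<sigma> \<eta> assume lr: "(l, r) \<in> set rs" and run: "run E \<sigma> l \<eta>"
      have "sat \<rho> (rule_form (l, r))" using sat lr by (auto simp: saturated_form_def)
      with sat_rule_form[of \<rho> S l r, OF S closed E[unfolded E_def] nv[OF lr] vars[OF lr]] run
      show "(subst \<sigma> r, \<eta> []) \<in> E" unfolding E_def by blast
    qed
    ultimately have "saturated \<Sigma> L (set rs) S E"
      unfolding saturated_def using fin S_ground closed E by (intro conjI)
    moreover have "ranks_ok S (\<rho> 6)"
      unfolding ranks_ok_def using Fun_S ranks S by auto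
    moreover have "\<rho> 4 = set_encode (term_code ` S)" "\<rho> 5 = set_encode (rule_code ` bta_rules S E)"
      using S decode_rules by (metis set_decode_inverse)+
    ultimately show ?P by blast
  }
  {
    assume ?P
    then obtain S E where codes: "\<rho> 4 = set_encode (term_code ` S)"
        "\<rho> 5 = set_encode (rule_code ` bta_rules S E)"
      and sat: "saturated \<Sigma> L (set rs) S E" and ranks: "ranks_ok S (\<rho> 6)"
      by blast
    have S: "finite S" "S \<subseteq> ground_terms \<Sigma>" "arg_closed S" "L \<subseteq> S" "E \<subseteq> S \<times> S" "refl_on S E" "trans E"
      using sat by (auto simp: saturated_def)
    have "finite E" by (rule finite_subset[OF S(5)]) (simp add: S(1))
    have E: "eps_rel (\<rho> 5) = E" unfolding codes(2) by (rule eps_rel_bta_rules[OF S(1) \<open>finite E\<close>])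
    have decode_rules: "set_decode (\<rho> 5) = rule_code ` bta_rules S E"
      unfolding codes(2) using \<open>finite E\<close> S(1) by (intro set_encode_inverse finite_imageI finite_bta_rules)
    have decode_S: "set_decode (\<rho> 4) = term_code ` S" using S(1) by (simp add: codes)
    have "sat \<rho> states_form"
      unfolding sat_states_form
    proof
      fix a assume "a \<in> set_decode (\<rho> 4)"
      then obtain t where t: "t \<in> S" "a = term_code t" by (auto simp: decode_S)
      with S(2) obtain f ts where f: "t = Fun f ts" by (cases t) (auto simp: ground_terms_def)
      have "f \<in> \<Sigma>" using t f S(2) by (auto simp: ground_terms_def terms_Fun_iff)
      moreover have "prod_encode (list_encode (map term_code ts), rank f) \<in> set_decode (\<rho> 6)"
        using ranks t f unfolding ranks_ok_def by blast
      moreover have "rule_code (Trans f (map term_code ts) a) \<in> set_decode (\<rho> 5)"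
        using t f unfolding decode_rules bta_rules_def by blast
      moreover have "(t, t) \<in> eps_rel (\<rho> 5)" using E S(6) t by (auto dest: refl_onD)
      ultimately show "\<exists>f as. a = fun_code (prod_encode f) as \<and>
          prod_encode f \<in> set_decode (\<rho> 1) \<and> prod_encode (as, rank f) \<in> set_decode (\<rho> 6) \<and>
          trans_code (prod_encode f) as a \<in> set_decode (\<rho> 5) \<and> eps_code a a \<in> set_decode (\<rho> 5)"
        using t(2) f by (intro exI[of _ f] exI[of _ "list_encode (map term_code ts)"])
          (simp add: alph[unfolded One_nat_def] term_code_Fun rule_code_codes eps_rel_def del: term_code.simps rule_code.simps)
    qed
    moreover have "sat \<rho> ranks_form"
      using ranks unfolding sat_ranks_form ranks_ok_def decode_S by blast
    moreover have "sat \<rho> rules_form"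
      unfolding sat_rules_form
    proof
      fix u assume "u \<in> set_decode (\<rho> 5)"
      then consider f ts where "Fun f ts \<in> S" "u = rule_code (Trans f (map term_code ts) (term_code (Fun f ts)))"
        | a b where "(a, b) \<in> E" "u = rule_code (Eps (term_code a) (term_code b))"
        unfolding decode_rules bta_rules_def by blast
      then show "(\<exists>f as. fun_code f as \<in> set_decode (\<rho> 4) \<and> u = trans_code f as (fun_code f as)) \<or>
         (\<exists>a \<in> set_decode (\<rho> 4). \<exists>b \<in> set_decode (\<rho> 4). u = eps_code a b)"
      proof cases
        case 1
        then have "fun_code (prod_encode f) (list_encode (map term_code ts)) \<in> set_decode (\<rho> 4)"
          unfolding decode_S term_code_Fun[symmetric] by (intro imageI)
        with 1 show ?thesis
          by (auto simp: term_code_Fun rule_code_codes simp del: term_code.simps rule_code.simps)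
      next
        case 2
        with S(5) show ?thesis
          by (auto simp: decode_S rule_code_codes simp del: term_code.simps rule_code.simps)
      qed
    qed
    moreover have "sat \<rho> (AllIn 7 2 (Mem (V 7) (V 4)))" using S(4) lang decode_S by auto
    moreover have "sat \<rho> trans_form"
      unfolding sat_trans_form decode_S
    proof (clarify)
      fix a b c assume "eps_code (term_code a) (term_code b) \<in> set_decode (\<rho> 5)"
        "eps_code (term_code b) (term_code c) \<in> set_decode (\<rho> 5)"
      then have "(a, b) \<in> eps_rel (\<rho> 5)" "(b, c) \<in> eps_rel (\<rho> 5)" by (auto simp: eps_rel_def)
      then have "(a, c) \<in> eps_rel (\<rho> 5)" using S(7) E by (auto dest: transD)
      then show "eps_code (term_code a) (term_code c) \<in> set_decode (\<rho> 5)" by (simp add: eps_rel_def)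
    qed
    moreover have "sat \<rho> (rule_form (l, r))" if "(l, r) \<in> set rs" for l r
      using sat_rule_form[of \<rho> S l r, OF decode_S S(3) _ nv[OF that] vars[OF that]] S(5) sat that
      unfolding E saturated_def by blast
    ultimately show "sat \<rho> (saturated_form rs)" unfolding saturated_form_def sat_Conj by auto
  }
qed

lemma ranks_ok_ex:
  assumes "finite S" "S \<subseteq> terms \<Sigma>" "arg_closed S"
  shows "\<exists>W. ranks_ok S W"
proof -
  \<comment> \<open>All tails of argument lists with their lengths. The range includes
    \<open>length ts\<close>, as the empty tail has to be certified too.\<close>
  define A where "A = (\<Union>t \<in> S. case t of Var x \<Rightarrow> {}
    | Fun f ts \<Rightarrow> (\<lambda>i. prod_encode (list_encode (map term_code (drop i ts)), length ts - i)) ` {..length ts})"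
  have "finite A" using assms(1) by (auto simp: A_def split: trm.splits)
  have A: "prod_encode (list_encode (map term_code (drop i ts)), length ts - i) \<in> A"
    if "Fun f ts \<in> S" "i \<le> length ts" for f ts i
    using that by (force simp: A_def)
  have "ranks_ok S (set_encode A)"
    unfolding ranks_ok_def set_encode_inverse[OF \<open>finite A\<close>]
  proof (intro conjI allI impI ballI)
    fix f ts assume f: "Fun f ts \<in> S"
    with assms(2) have "length ts = rank f" by (auto simp: terms_Fun_iff)
    with A[OF f, of 0] show "prod_encode (list_encode (map term_code ts), rank f) \<in> A" by simp
  next
    fix w assume "w \<in> A"
    then obtain t where t: "t \<in> S" "w \<in> (case t of Var x \<Rightarrow> {} | Fun f ts \<Rightarrow>
        (\<lambda>i. prod_encode (list_encode (map term_code (drop i ts)), length ts - i)) ` {..length ts})"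
      unfolding A_def by blast
    then obtain f ts i where f: "Fun f ts \<in> S" "i \<le> length ts"
      and w: "w = prod_encode (list_encode (map term_code (drop i ts)), length ts - i)"
      by (cases t) auto
    show "w = prod_encode (0, 0) \<or> (\<exists>x \<in> term_code ` S. \<exists>as n.
        w = prod_encode (Suc (prod_encode (x, as)), Suc n) \<and> prod_encode (as, n) \<in> A)"
    proof (cases "i = length ts")
      case False
      then have i: "drop i ts = ts ! i # drop (Suc i) ts" "length ts - i = Suc (length ts - Suc i)"
        using f(2) by (simp_all add: Cons_nth_drop_Suc)
      moreover have "ts ! i \<in> S" using arg_closed_nth[OF assms(3) f(1)] False f(2) by simp
      moreover have "Suc i \<le> length ts" using False f(2) by simp
      ultimately show ?thesis using A[OF f(1), of "Suc i"] w by auto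
    qed (simp add: w)
  qed
  then show ?thesis by blast
qed

text \<open>A subset of a finite set has a smaller code, so the least code belongs to a relation without
  proper saturated subrelations.\<close>

definition minimal_form :: "(gterm \<times> gterm) list \<Rightarrow> form" where
  "minimal_form rs = And (saturated_form rs) (Forall 5 (V 5) (Neg (saturated_form rs)))"

lemma sat_minimal_form:
  assumes "\<rho> 1 = alphabet_code \<Sigma>" "\<rho> 2 = lang_code L" "finite \<Sigma>" "finite L" "L \<subseteq> ground_terms \<Sigma>"
    and "trs \<Sigma>' (set rs)" "\<forall>(l, r) \<in> set rs. \<not> is_Var l" "left_linear (set rs)"
    and sat: "sat \<rho> (minimal_form rs)"
  shows "\<exists>C. bta_code C = prod_encode (\<rho> 1, prod_encode (\<rho> 4, prod_encode (\<rho> 5, \<rho> 2))) \<and>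
    bta_over \<Sigma> C \<and> bta_lang C = descendants (set rs) L"
proof -
  let ?R = "set rs"
  note iff = sat_saturated_form[OF _ _ assms(3-7)]
  from sat have "sat \<rho> (saturated_form rs)"
    and least: "\<And>u. u < \<rho> 5 \<Longrightarrow> \<not> sat (\<rho>(5 := u)) (saturated_form rs)"
    by (auto simp: minimal_form_def)
  then obtain S E where codes: "\<rho> 4 = set_encode (term_code ` S)"
      "\<rho> 5 = set_encode (rule_code ` bta_rules S E)"
    and S: "saturated \<Sigma> L ?R S E" and ranks: "ranks_ok S (\<rho> 6)"
    using iff[of \<rho>] assms(1,2) by blast
  have fin: "finite S" "finite E"
    using S by (auto simp: saturated_def intro: finite_subset)
  let ?E = "{(a, b) \<in> E. (rstep ?R)\<^sup>*\<^sup>* b a}"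
  let ?u = "set_encode (rule_code ` bta_rules S ?E)"
  have E: "saturated \<Sigma> L ?R S ?E" by (rule saturated_sound_part[OF S])
  have finE: "finite ?E" by (rule finite_subset[OF _ fin(2)]) auto
  \<comment> \<open>The sound part has the same states, so the names 4 and 6 keep their values and
    only the rules change, as in the minimality clause.\<close>
  have "sat (\<rho>(5 := ?u)) (saturated_form rs)"
    by (rule iffD2[OF iff], goal_cases)
      (use assms(1,2) codes(1) E ranks in \<open>auto intro!: exI[of _ S] exI[of _ ?E]\<close>)
  with least have "\<not> ?u < \<rho> 5" by blast
  moreover have "?u \<le> \<rho> 5"
  proof (rule subset_decode_imp_le)
    have "rule_code ` bta_rules S ?E \<subseteq> rule_code ` bta_rules S E" by (auto simp: bta_rules_def)
    then show "set_decode ?u \<subseteq> set_decode (\<rho> 5)"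
      using fin finE by (simp add: codes finite_bta_rules)
  qed
  ultimately have u: "?u = \<rho> 5" by simp
  have "?E = eps_rel ?u" by (rule eps_rel_bta_rules[OF fin(1) finE, symmetric])
  also have "\<dots> = E" unfolding u codes(2) by (rule eps_rel_bta_rules[OF fin])
  finally have "?E = E" .
  then have "(rstep ?R)\<^sup>*\<^sup>* b a" if "(a, b) \<in> E" for a b using that by blast
  from accepts_descendants[OF S assms(6,8) this]
  have "bta_lang (term_bta \<Sigma> L S E) = descendants ?R L"
    using bta_lang_term_bta[OF S] by simp
  with bta_over_term_bta[OF S] bta_code_term_bta[of \<Sigma> L S E] codes assms(1,2) show ?thesis
    by (intro exI[of _ "term_bta \<Sigma> L S E"]) simp
qed

text \<open>Moves a solution between the environments of the two searches, which differ at the names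
  0 and 3. It is read off the meaning of the formula, without an account of free variables.\<close>

lemma sat_minimal_form_cong:
  assumes "\<rho> 1 = alphabet_code \<Sigma>" "\<rho> 2 = lang_code L" "\<rho>' 1 = \<rho> 1" "\<rho>' 2 = \<rho> 2" "\<rho>' 4 = \<rho> 4"
    "\<rho>' 5 = \<rho> 5" "\<rho>' 6 = \<rho> 6"
    and "finite \<Sigma>" "finite L" "L \<subseteq> ground_terms \<Sigma>"
    and "trs \<Sigma>' (set rs)" "\<forall>(l, r) \<in> set rs. \<not> is_Var l"
  shows "sat \<rho> (minimal_form rs) \<longleftrightarrow> sat \<rho>' (minimal_form rs)"
proof -
  have "sat (\<rho>(5 := y)) (saturated_form rs) \<longleftrightarrow> sat (\<rho>'(5 := y)) (saturated_form rs)" for y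
    using sat_saturated_form[of "\<rho>(5 := y)", OF _ _ assms(8-12)]
      sat_saturated_form[of "\<rho>'(5 := y)", OF _ _ assms(8-12)] assms(1-5,7) by simp
  from this[of "\<rho> 5"] this show ?thesis
    using assms(6) by (simp add: minimal_form_def fun_upd_idem)
qed

text \<open>For the states of \<open>rhs_eps\<close> and a fixed rank witness, some code of rules
  works, so there is a least one. Its relation may be smaller than \<open>rhs_eps\<close>.\<close>

lemma sat_minimal_form_ex:
  assumes "finite \<Sigma>" "finite L" "L \<subseteq> ground_terms \<Sigma>" "trs \<Sigma> (set rs)" "gsm_trs \<Sigma>' (set rs)"
  shows "\<exists>s u w. \<forall>\<rho>. \<rho> 1 = alphabet_code \<Sigma> \<longrightarrow> \<rho> 2 = lang_code L \<longrightarrow> \<rho> 4 = s \<longrightarrow> \<rho> 5 = u \<longrightarrow> \<rho> 6 = w \<longrightarrow>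
    sat \<rho> (minimal_form rs)"
proof -
  let ?R = "set rs"
  define S where "S = rhs_states ?R L"
  have nv: "\<forall>(l, r) \<in> ?R. \<not> is_Var l" using assms(5) by (simp add: gsm_trs_def)
  note iff = sat_saturated_form[OF _ _ assms(1-4) nv]
  have S: "saturated \<Sigma> L ?R S (rhs_eps ?R L)"
    unfolding S_def using assms by (intro saturated_rhs_eps)
  then obtain w where w: "ranks_ok S w"
    using ranks_ok_ex[of S \<Sigma>] by (auto simp: saturated_def ground_terms_def)
  define P where "P u \<longleftrightarrow> (\<exists>S' E. set_encode (term_code ` S) = set_encode (term_code ` S') \<and>
    u = set_encode (rule_code ` bta_rules S' E) \<and> saturated \<Sigma> L ?R S' E \<and> ranks_ok S' w)" for u
  define u where "u = (LEAST u. P u)"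
  have "P (set_encode (rule_code ` bta_rules S (rhs_eps ?R L)))" using S w by (auto simp: P_def)
  then have "P u" unfolding u_def by (rule LeastI)
  moreover have "\<not> P y" if "y < u" for y using that unfolding u_def by (rule not_less_Least)
  ultimately have "sat \<rho> (minimal_form rs)"
    if "\<rho> 1 = alphabet_code \<Sigma>" "\<rho> 2 = lang_code L" "\<rho> 4 = set_encode (term_code ` S)" "\<rho> 5 = u" "\<rho> 6 = w"
    for \<rho>
    unfolding minimal_form_def using that iff[of \<rho>] iff[of "\<rho>(5 := _)"] by (auto simp: P_def)
  then show ?thesis by blast
qed

theorem mainTheorem1:
  fixes \<Sigma> :: "symb set" and R :: "(symb, nat) rule set"
  assumes "ranked_alphabet \<Sigma>"
    and "gsm_trs \<Sigma> R"
    and "left_linear R"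
  shows "eprf_trs R"
proof -
  have trs: "trs \<Sigma> R" using assms(2) by (simp add: gsm_trs_def)
  then obtain rs where R: "R = set rs" by (metis trs_def finite_list)
  have trs': "trs \<Sigma>' R" if "sign R \<subseteq> \<Sigma>'" for \<Sigma>'
    unfolding trs_def
  proof (intro conjI ballI)
    show "finite R" using trs by (simp add: trs_def)
    fix \<rho> assume "\<rho> \<in> R"
    moreover obtain l r where lr: "\<rho> = (l, r)" by (cases \<rho>)
    ultimately have "funs l \<subseteq> \<Sigma>'" "funs r \<subseteq> \<Sigma>'" "l \<in> terms \<Sigma>" "r \<in> terms \<Sigma>" "vars r \<subseteq> vars l"
      using that trs by (auto simp: sign_def trs_def)
    then show "case \<rho> of (l, r) \<Rightarrow> l \<in> terms \<Sigma>' \<and> r \<in> terms \<Sigma>' \<and> vars r \<subseteq> vars l"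
      using lr by (auto intro: terms_funs)
  qed
  have nv: "\<forall>(l, r) \<in> R. \<not> is_Var l" using assms(2) by (simp add: gsm_trs_def)
  \<comment> \<open>With bounded quantifiers only, the first search looks for a common bound of
    states, rules and rank witness. The second search takes this bound as an input, since the code
    of the automaton does not limit the rank witness.\<close>
  define \<phi> where "\<phi> = Exists 4 (V 0) (Exists 5 (V 0) (Exists 6 (V 0) (minimal_form rs)))"
  define \<psi> where "\<psi> = Exists 4 (V 3) (Exists 5 (V 3) (Exists 6 (V 3) (And (minimal_form rs)
    (Eq (V 0) (Pr (V 1) (Pr (V 4) (Pr (V 5) (V 2))))))))"
  obtain e1 where e1: "\<And>xs. length xs = 2 \<Longrightarrow> \<exists>m. sat (env (m # xs)) \<phi> \<Longrightarrow>
      \<exists>m. computes e1 xs m \<and> sat (env (m # xs)) \<phi>"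
    using computes_search[of 2 \<phi>] by blast
  obtain e2 where e2: "\<And>xs. length xs = 3 \<Longrightarrow> \<exists>m. sat (env (m # xs)) \<psi> \<Longrightarrow>
      \<exists>m. computes e2 xs m \<and> sat (env (m # xs)) \<psi>"
    using computes_search[of 3 \<psi>] by blast
  define e where "e = Comp e2 [Proj 0, Proj 1, e1]"
  have "\<exists>C. computes e [alphabet_code \<Sigma>', lang_code L] (bta_code C) \<and>
      bta_over \<Sigma>' C \<and> bta_lang C = descendants R L"
    if asm: "ranked_alphabet \<Sigma>'" "sign R \<subseteq> \<Sigma>'" "finite L" "L \<subseteq> ground_terms \<Sigma>'" for \<Sigma>' L
  proof -
    let ?a = "alphabet_code \<Sigma>'" and ?b = "lang_code L"
    have fin: "finite \<Sigma>'" using asm by (simp add: ranked_alphabet_def)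
    have env: "env (m # ?a # ?b # xs) 0 = m" "env (m # ?a # ?b # xs) 1 = ?a"
      "env (m # ?a # ?b # xs) 2 = ?b" "env (m # ?a # ?b # n # xs) 3 = n"
      "env (m # ?a # ?b # xs) (Suc 0) = ?a"
      for m n xs by (simp_all add: env_def numeral_2_eq_2 numeral_3_eq_3)
    note minimal_cong = sat_minimal_form_cong[OF _ _ _ _ _ _ _ fin asm(3,4)
      trs'[OF asm(2), unfolded R] nv[unfolded R]]
    obtain s u w where suw: "\<And>\<rho>. \<rho> 1 = ?a \<Longrightarrow> \<rho> 2 = ?b \<Longrightarrow> \<rho> 4 = s \<Longrightarrow> \<rho> 5 = u \<Longrightarrow> \<rho> 6 = w \<Longrightarrow>
        sat \<rho> (minimal_form rs)"
      using sat_minimal_form_ex[OF fin asm(3,4), of rs \<Sigma>] trs'[OF asm(2)] assms(2) R by metis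
    obtain bd where bd: "s < bd" "u < bd" "w < bd"
      using that[of "Suc (max s (max u w))"] by auto
    have "sat ((env [bd, ?a, ?b])(4 := s, 5 := u, 6 := w)) (minimal_form rs)"
      by (rule suw) (simp_all add: env)
    then have "sat (env [bd, ?a, ?b]) \<phi>"
      unfolding \<phi>_def using bd by (auto simp: env)
    with e1[of "[?a, ?b]"] obtain n where n: "computes e1 [?a, ?b] n" "sat (env [n, ?a, ?b]) \<phi>"
      by auto
    from n(2) obtain s' u' w' where bounds: "s' < n" "u' < n" "w' < n"
      and sat: "sat ((env [n, ?a, ?b])(4 := s', 5 := u', 6 := w')) (minimal_form rs)"
      by (auto simp: \<phi>_def env)
    let ?c = "prod_encode (?a, prod_encode (s', prod_encode (u', ?b)))"
    have "sat ((env [?c, ?a, ?b, n])(4 := s', 5 := u', 6 := w')) (minimal_form rs)"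
      by (rule iffD1[OF minimal_cong sat]) (simp_all add: env)
    with bounds have "sat (env [?c, ?a, ?b, n]) \<psi>"
      unfolding \<psi>_def by (auto simp: env)
    with e2[of "[?a, ?b, n]"] obtain c where c: "computes e2 [?a, ?b, n] c" "sat (env [c, ?a, ?b, n]) \<psi>"
      by auto
    \<comment> \<open>The second search may stop at a code whose witnesses differ from the earlier
      ones; any that satisfy \<open>minimal_form\<close> will do.\<close>
    from c(2) obtain s u w where
      sat: "sat ((env [c, ?a, ?b, n])(4 := s, 5 := u, 6 := w)) (minimal_form rs)" (is "sat ?\<rho> _")
      and c_eq: "c = prod_encode (?a, prod_encode (s, prod_encode (u, ?b)))"
      by (auto simp: \<psi>_def env)
    obtain C where C: "bta_code C = c" "bta_over \<Sigma>' C" "bta_lang C = descendants R L"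
      using sat_minimal_form[of ?\<rho> \<Sigma>' L \<Sigma>' rs, OF _ _ fin asm(3,4) _ _ _ sat] trs'[OF asm(2)] nv assms(3) R c_eq
      by (auto simp: env)
    have "computes e [?a, ?b] c"
      unfolding e_def
    proof (rule computes.Comp)
      show "list_all2 (\<lambda>g. computes g [?a, ?b]) [Proj 0, Proj 1, e1] [?a, ?b, n]"
        using n(1) computes.Proj[of 0 "[?a, ?b]"] computes.Proj[of 1 "[?a, ?b]"] by simp
    qed (rule c(1))
    with C show ?thesis by blast
  qed
  with trs'[of "sign R"] show ?thesis unfolding eprf_trs_def by blast
qed

end
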